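(* Let $n\in\mathbb N$, let $X_1,\dots,X_n$ be $\mathcal L_1$ spaces and let $Y$ be an $\mathcal L_2$ space (all Banach spaces over the same field $\mathbb R$ or $\mathbb C$). Then $$\Pi_1^{Lip}(X_1,\dots,X_n;Y)=\mathcal L(X_1,\dots,X_n;Y),$$ that is, every bounded $n$-linear operator from $X_1\times\cdots\times X_n$ to $Y$ is Lipschitz $1$-summing.
   Context: $\mathcal L(X_1,\dots,X_n;Y)$ is the space of bounded $n$-linear operators, $\mathcal L(X_1,\dots,X_n)$ the space of bounded scalar $n$-linear forms with the supremum norm over the product of unit balls, $B_E$ the closed unit ball of $E$. For $1\le p<\infty$, $T\in\mathcal L(X_1,\dots,X_n;Y)$ is Lipschitz $p$-summing, $T\in\Pi_p^{Lip}(X_1,\dots,X_n;Y)$, if there is $c>0$ such that for all $k\in\mathbb N$ and all $u_1,\dots,u_k,v_1,\dots,v_k\in X_1\times\cdots\times X_n$, $$\Big(\sum_{i=1}^k\|T(u_i)-T(v_i)\|^p\Big)^{1/p}\le c\cdot\sup_{\varphi\in B_{\mathcal L(X_1,\dots,X_n)}}\Big(\sum_{i=1}^k|\varphi(u_i)-\varphi(v_i)|^p\Big)^{1/p}.$$ $\mathcal L_p$ spaces are in the sense of Lindenstrauss-Pełczyński: $X$ is an $\mathcal L_p$ space if for some $\lambda\ge1$ every finite dimensional subspace of $X$ is contained in a finite dimensional subspace $F\subset X$ admitting an isomorphism $v:F\to\ell_p^{\dim F}$ with $\|v\|\,\|v^{-1}\|\le\lambda$. *)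

theory Defs
  imports "HOL-Analysis.Analysis"
begin

(* The scalar field is the real or the complex numbers.  A multiplicative norm extending
   the absolute value of the reals is unique on both fields, so up to isometric isomorphism
   the two instances below are the only ones. *)
class real_or_complex = real_normed_field +
  assumes real_or_complex:
    "(\<forall>x. \<exists>a. x = a *\<^sub>R 1) \<or>
     (\<exists>j. j * j = - 1 \<and> (\<forall>x. \<exists>a b. x = a *\<^sub>R 1 + b *\<^sub>R j))"

instance real :: real_or_complex
  by standard simp

instance complex :: real_or_complex
proof
  have "\<exists>a b. x = a *\<^sub>R 1 + b *\<^sub>R \<i>" for x
    by (rule exI[of _ "Re x"], rule exI[of _ "Im x"]) (simp add: complex_eq_iff)
  then show "(\<forall>x::complex. \<exists>a. x = a *\<^sub>R 1) \<or>
    (\<exists>j::complex. j * j = - 1 \<and> (\<forall>x. \<exists>a b. x = a *\<^sub>R 1 + b *\<^sub>R j))"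
    by (intro disjI2 exI[of _ \<i>]) simp
qed

locale normed_space_over = vector_space scale
  for scale :: "'k::real_or_complex \<Rightarrow> 'a::real_normed_vector \<Rightarrow> 'a" +
  assumes scale_of_real: "scale (of_real r) x = r *\<^sub>R x"
    and norm_scale: "norm (scale c x) = norm c * norm x"

lemma normed_space_over_scaleR:
  "normed_space_over (scaleR :: real \<Rightarrow> 'a::real_normed_vector \<Rightarrow> 'a)"
  by unfold_locales (auto simp: algebra_simps)

lemma normed_space_over_field:
  "normed_space_over ((*) :: 'k::real_or_complex \<Rightarrow> 'k \<Rightarrow> 'k)"
  by unfold_locales (auto simp: algebra_simps norm_mult scaleR_conv_of_real)


(* The space of m-tuples of scalars with the p-norm, 1 <= p < infinity; a tuple is
   padded with zeros from index m on. *)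
definition lp_carrier :: "nat \<Rightarrow> (nat \<Rightarrow> 'k::real_or_complex) set" where
  "lp_carrier m = {x. \<forall>i\<ge>m. x i = 0}"

definition lp_norm :: "real \<Rightarrow> nat \<Rightarrow> (nat \<Rightarrow> 'k::real_or_complex) \<Rightarrow> real" where
  "lp_norm p m x = (\<Sum>i<m. norm (x i) powr p) powr (1 / p)"

definition map_bounded :: "'a set \<Rightarrow> ('a \<Rightarrow> real) \<Rightarrow> ('b \<Rightarrow> real) \<Rightarrow> ('a \<Rightarrow> 'b) \<Rightarrow> bool" where
  "map_bounded F N M v \<longleftrightarrow> (\<exists>C. \<forall>x\<in>F. M (v x) \<le> C * N x)"

definition map_norm :: "'a set \<Rightarrow> ('a \<Rightarrow> real) \<Rightarrow> ('b \<Rightarrow> real) \<Rightarrow> ('a \<Rightarrow> 'b) \<Rightarrow> real" where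
  "map_norm F N M v = (SUP x\<in>{x\<in>F. N x \<le> 1}. M (v x))"

context normed_space_over
begin

definition finite_dimensional_subspace :: "'a set \<Rightarrow> bool" where
  "finite_dimensional_subspace F \<longleftrightarrow> (\<exists>B. finite B \<and> F = span B)"

definition lp_isomorphism :: "real \<Rightarrow> 'a set \<Rightarrow> ('a \<Rightarrow> nat \<Rightarrow> 'k) \<Rightarrow> bool" where
  "lp_isomorphism p F v \<longleftrightarrow>
     bij_betw v F (lp_carrier (dim F)) \<and>
     (\<forall>x\<in>F. \<forall>y\<in>F. v (x + y) = (\<lambda>i. v x i + v y i)) \<and>
     (\<forall>c. \<forall>x\<in>F. v (scale c x) = (\<lambda>i. c * v x i)) \<and>
     map_bounded F norm (lp_norm p (dim F)) v \<and>
     map_bounded (lp_carrier (dim F)) (lp_norm p (dim F)) norm (inv_into F v)"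

definition script_L_space :: "real \<Rightarrow> 'a set \<Rightarrow> bool" where
  "script_L_space p X \<longleftrightarrow>
     (\<exists>l\<ge>1. \<forall>E. finite_dimensional_subspace E \<and> E \<subseteq> X \<longrightarrow>
        (\<exists>F v. finite_dimensional_subspace F \<and> E \<subseteq> F \<and> F \<subseteq> X \<and> lp_isomorphism p F v \<and>
           map_norm F norm (lp_norm p (dim F)) v *
           map_norm (lp_carrier (dim F)) (lp_norm p (dim F)) norm (inv_into F v) \<le> l))"

end


(* The factors X 1, ..., X n are subspaces of one ambient normed space, which lets them
   be different spaces although n is a variable.  This loses no generality: any finite family
   of Banach spaces sits isometrically, as complete subspaces, in its direct sum.
   An element of the product is an extensional function on {1..n}; multilinear maps are
   functions on the whole function type of which only the values on the product matter. *)
definition bounded_multilinear ::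
  "('k::real_or_complex \<Rightarrow> 'a::real_normed_vector \<Rightarrow> 'a) \<Rightarrow> ('k \<Rightarrow> 'b::real_normed_vector \<Rightarrow> 'b) \<Rightarrow>
   nat \<Rightarrow> (nat \<Rightarrow> 'a set) \<Rightarrow> ((nat \<Rightarrow> 'a) \<Rightarrow> 'b) set" where
  "bounded_multilinear sX sY n X = {T.
     (\<forall>u\<in>Pi\<^sub>E {1..n} X. \<forall>i\<in>{1..n}. \<forall>x\<in>X i. \<forall>y\<in>X i.
        T (u(i := x + y)) = T (u(i := x)) + T (u(i := y))) \<and>
     (\<forall>u\<in>Pi\<^sub>E {1..n} X. \<forall>i\<in>{1..n}. \<forall>x\<in>X i. \<forall>c.
        T (u(i := sX c x)) = sY c (T (u(i := x)))) \<and>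
     (\<exists>C. \<forall>u\<in>Pi\<^sub>E {1..n} X. norm (T u) \<le> C * (\<Prod>i\<in>{1..n}. norm (u i)))}"

definition multilinear_norm ::
  "nat \<Rightarrow> (nat \<Rightarrow> 'a::real_normed_vector set) \<Rightarrow> ((nat \<Rightarrow> 'a) \<Rightarrow> 'b::real_normed_vector) \<Rightarrow> real" where
  "multilinear_norm n X T = (SUP u\<in>Pi\<^sub>E {1..n} (\<lambda>i. X i \<inter> cball 0 1). norm (T u))"

definition form_ball ::
  "('k::real_or_complex \<Rightarrow> 'a::real_normed_vector \<Rightarrow> 'a) \<Rightarrow> nat \<Rightarrow> (nat \<Rightarrow> 'a set) \<Rightarrow>
   ((nat \<Rightarrow> 'a) \<Rightarrow> 'k) set" where
  "form_ball sX n X = {\<phi> \<in> bounded_multilinear sX (*) n X. multilinear_norm n X \<phi> \<le> 1}"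

definition lipschitz_summing ::
  "real \<Rightarrow> ('k::real_or_complex \<Rightarrow> 'a::real_normed_vector \<Rightarrow> 'a) \<Rightarrow>
   ('k \<Rightarrow> 'b::real_normed_vector \<Rightarrow> 'b) \<Rightarrow>
   nat \<Rightarrow> (nat \<Rightarrow> 'a set) \<Rightarrow> ((nat \<Rightarrow> 'a) \<Rightarrow> 'b) set" where
  "lipschitz_summing p sX sY n X = {T \<in> bounded_multilinear sX sY n X.
     \<exists>c>0. \<forall>k. \<forall>u v :: nat \<Rightarrow> nat \<Rightarrow> 'a.
       (\<forall>i\<in>{1..k}. u i \<in> Pi\<^sub>E {1..n} X \<and> v i \<in> Pi\<^sub>E {1..n} X) \<longrightarrow>
       (\<Sum>i\<in>{1..k}. norm (T (u i) - T (v i)) powr p) powr (1 / p) \<le>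
       c * (SUP \<phi>\<in>form_ball sX n X.
              (\<Sum>i\<in>{1..k}. norm (\<phi> (u i) - \<phi> (v i)) powr p) powr (1 / p))}"

end

theory Submission
  imports Defs
begin

text \<open>
The theorem rests on Grothendieck's inequality: operators from \<open>\<ell>\<^sub>1\<close> to \<open>\<ell>\<^sub>2\<close> are absolutely summing, with
a constant that does not depend on the dimensions.  It carries over to several variables because an
\<open>n\<close>-linear map on a product of spaces \<open>\<ell>\<^sub>1\<close> is the same as a bounded family of values at tuples of
unit vectors, that is, a linear map on \<open>\<ell>\<^sub>1\<close> of the set of tuples.  Differences \<open>T u - T v\<close> are values
of this linear map, whence a Lipschitz estimate.

Grothendieck's inequality is proved on finite cubes of signs (\<open>vector_sum_bound_improve\<close>).  Rademacher
sums represent Euclidean vectors by functions on a cube.  Truncated at a fixed level, these functions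
are bounded scalars at every point of the cube, so the scalar hypothesis applies to them; the
remainders have small \<open>L\<^sub>2\<close> norm by the fourth moment inequality, so they contribute a small multiple of
the very quantity to be estimated, which can be absorbed.  Splitting into real and imaginary parts
reduces the inequality for the scalar field to the real one.

Given finitely many points of the product, the script-L property supplies subspaces \<open>F j\<close> of the
factors that contain their components and are close to \<open>\<ell>\<^sub>1\<close>, and a subspace of the target that contains
all values at tuples of basis vectors and is close to \<open>\<ell>\<^sub>2\<close>.  Grothendieck's inequality then bounds the
sum of the \<open>norm (T (u i) - T (v i))\<close> by means of forms on the product of the \<open>F j\<close>
(\<open>multilinear_local_estimate\<close>).  Such a form need not extend to the whole product with the same bound.
But the estimate holds for arbitrarily large \<open>F j\<close> with the same constant, and a compactness
argument assembles the forms so obtained into one on the whole product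
(\<open>form_ball_compactness\<close>).
\<close>

section \<open>Rademacher sums\<close>

text \<open>
The sum of the \<open>x k\<close> with random signs, as a function on the cube \<open>Pow D\<close>: a point \<open>S\<close> of the
cube is the set of indices that get the sign \<open>+\<close>.  Sums over \<open>Pow D\<close> are expectations up to the
factor \<open>2 ^ card D\<close>.
\<close>

definition rademacher_sum :: "nat set \<Rightarrow> (nat \<Rightarrow> real) \<Rightarrow> nat set \<Rightarrow> real" where
  "rademacher_sum D x S = (\<Sum>k\<in>D. if k \<in> S then x k else - x k)"

lemma sum_Pow_insert:
  fixes f :: "'a set \<Rightarrow> 'b::comm_monoid_add"
  assumes "finite D" "a \<notin> D"
  shows "(\<Sum>S\<in>Pow (insert a D). f S) = (\<Sum>S\<in>Pow D. f S + f (insert a S))"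
proof -
  have "inj_on (insert a) (Pow D)"
    using assms(2) by (auto simp: inj_on_def)
  then have "(\<Sum>S\<in>insert a ` Pow D. f S) = (\<Sum>S\<in>Pow D. f (insert a S))"
    by (simp add: sum.reindex)
  moreover have "Pow D \<inter> insert a ` Pow D = {}"
    using assms(2) by auto
  ultimately show ?thesis
    using assms(1) by (simp add: Pow_insert sum.union_disjoint sum.distrib)
qed

lemma rademacher_sum_insert:
  assumes "finite D" "a \<notin> D" "S \<subseteq> D"
  shows "rademacher_sum (insert a D) x S = rademacher_sum D x S - x a"
    and "rademacher_sum (insert a D) x (insert a S) = rademacher_sum D x S + x a"
proof -
  show "rademacher_sum (insert a D) x S = rademacher_sum D x S - x a"
    using assms by (auto simp: rademacher_sum_def)
  have "(\<Sum>k\<in>D. if k \<in> insert a S then x k else - x k) = (\<Sum>k\<in>D. if k \<in> S then x k else - x k)"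
    using assms by (intro sum.cong) auto
  then show "rademacher_sum (insert a D) x (insert a S) = rademacher_sum D x S + x a"
    using assms by (simp add: rademacher_sum_def)
qed

text \<open>
Signs of different indices are uncorrelated, so Rademacher sums embed Euclidean space isometrically,
up to normalisation, into the functions on the cube.
\<close>

lemma rademacher_sum_inner:
  assumes "finite D"
  shows "(\<Sum>S\<in>Pow D. rademacher_sum D x S * rademacher_sum D y S) = 2 ^ card D * (\<Sum>k\<in>D. x k * y k)"
  using assms
proof (induction D rule: finite_induct)
  case empty
  then show ?case by (simp add: rademacher_sum_def)
next
  case (insert a D)
  let ?X = "rademacher_sum D x" and ?Y = "rademacher_sum D y"
  have "(\<Sum>S\<in>Pow (insert a D). rademacher_sum (insert a D) x S * rademacher_sum (insert a D) y S)
      = (\<Sum>S\<in>Pow D. (?X S - x a) * (?Y S - y a) + (?X S + x a) * (?Y S + y a))"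
    unfolding sum_Pow_insert[OF insert.hyps(1,2)]
    using insert.hyps by (intro sum.cong) (simp_all add: rademacher_sum_insert)
  also have "\<dots> = (\<Sum>S\<in>Pow D. 2 * (?X S * ?Y S) + 2 * (x a * y a))"
    by (intro sum.cong) (simp_all add: algebra_simps)
  also have "\<dots> = 2 * (2 ^ card D * (\<Sum>k\<in>D. x k * y k)) + 2 ^ card D * (2 * (x a * y a))"
    using insert.hyps by (simp add: sum.distrib sum_distrib_left[symmetric] insert.IH card_Pow)
  finally show ?case
    using insert.hyps by (simp add: algebra_simps)
qed

text \<open>
This is the Khinchine inequality for the exponent 4.  Averaging \<open>(X - t) ^ 4\<close> and \<open>(X + t) ^ 4\<close> over
the sign of a new index kills the odd powers of \<open>t\<close>, and what is left, \<open>X ^ 4 + 6 t\<^sup>2 X\<^sup>2 + t ^ 4\<close>, is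
controlled by the square of the enlarged sum of squares.
\<close>

lemma rademacher_sum_fourth_moment:
  assumes "finite D"
  shows "(\<Sum>S\<in>Pow D. rademacher_sum D x S ^ 4) \<le> 2 ^ card D * (3 * (\<Sum>k\<in>D. (x k)\<^sup>2)\<^sup>2)"
  using assms
proof (induction D rule: finite_induct)
  case empty
  then show ?case by (simp add: rademacher_sum_def)
next
  case (insert a D)
  let ?X = "rademacher_sum D x" and ?A = "\<Sum>k\<in>D. (x k)\<^sup>2" and ?n = "2 ^ card D :: real"
  have sq: "(\<Sum>S\<in>Pow D. (?X S)\<^sup>2) = ?n * ?A"
    using rademacher_sum_inner[OF insert.hyps(1), of x x] by (simp add: power2_eq_square)
  have "(\<Sum>S\<in>Pow (insert a D). rademacher_sum (insert a D) x S ^ 4)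
      = (\<Sum>S\<in>Pow D. (?X S - x a) ^ 4 + (?X S + x a) ^ 4)"
    unfolding sum_Pow_insert[OF insert.hyps(1,2)]
    using insert.hyps by (intro sum.cong) (simp_all add: rademacher_sum_insert)
  also have "\<dots> = (\<Sum>S\<in>Pow D. 2 * ?X S ^ 4 + 12 * (x a)\<^sup>2 * (?X S)\<^sup>2 + 2 * x a ^ 4)"
    by (intro sum.cong refl) (simp add: power4_eq_xxxx power2_eq_square algebra_simps)
  also have "\<dots> = 2 * (\<Sum>S\<in>Pow D. ?X S ^ 4) + 12 * (x a)\<^sup>2 * (?n * ?A) + ?n * (2 * x a ^ 4)"
    using insert.hyps
    by (simp add: sum.distrib sum_distrib_left[symmetric] card_Pow sq)
  also have "\<dots> \<le> 2 * (?n * (3 * ?A\<^sup>2)) + 12 * (x a)\<^sup>2 * (?n * ?A) + ?n * (6 * x a ^ 4)"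
    using insert.IH by (intro add_mono mult_left_mono) auto
  also have "\<dots> = 2 * ?n * (3 * (?A + (x a)\<^sup>2)\<^sup>2)"
    by (simp add: power4_eq_xxxx power2_eq_square algebra_simps)
  also have "\<dots> = 2 ^ card (insert a D) * (3 * (\<Sum>k\<in>insert a D. (x k)\<^sup>2)\<^sup>2)"
    using insert.hyps by (simp add: add.commute)
  finally show ?case .
qed

section \<open>Grothendieck's inequality over the reals\<close>

text \<open>
The bilinear form with matrix \<open>w\<close>, evaluated at vectors in place of scalars, is at most \<open>c\<close> on the
Euclidean unit balls of all finite dimensions.  Quantifying over all finite sets \<open>D\<close> makes the
predicate insensitive to the dimension, which is essential because the cube of signs of a
\<open>d\<close>-dimensional space has \<open>2 ^ d\<close> points.
\<close>

definition vector_sum_bound ::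
  "'i set \<Rightarrow> 'a set \<Rightarrow> ('i \<Rightarrow> 'a \<Rightarrow> real) \<Rightarrow> real \<Rightarrow> bool" where
  "vector_sum_bound I A w c \<longleftrightarrow> (\<forall>(D :: nat set) x y. finite D \<longrightarrow>
     (\<forall>a\<in>A. (\<Sum>k\<in>D. (x a k)\<^sup>2) \<le> 1) \<longrightarrow> (\<forall>i\<in>I. (\<Sum>k\<in>D. (y i k)\<^sup>2) \<le> 1) \<longrightarrow>
     (\<Sum>i\<in>I. \<Sum>a\<in>A. w i a * (\<Sum>k\<in>D. x a k * y i k)) \<le> c)"

text \<open>
By homogeneity and renumbering, the bound applies to vectors of any norm with coordinates in any
finite set, in particular to functions on a cube of signs.
\<close>

lemma vector_sum_boundD:
  fixes x :: "'a \<Rightarrow> 'o \<Rightarrow> real" and y :: "'i \<Rightarrow> 'o \<Rightarrow> real"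
  assumes P: "vector_sum_bound I A w c" and fin: "finite \<Omega>"
    and al: "\<alpha> > 0" and be: "\<beta> > 0"
    and x: "\<And>a. a \<in> A \<Longrightarrow> (\<Sum>s\<in>\<Omega>. (x a s)\<^sup>2) \<le> \<alpha>\<^sup>2"
    and y: "\<And>i. i \<in> I \<Longrightarrow> (\<Sum>s\<in>\<Omega>. (y i s)\<^sup>2) \<le> \<beta>\<^sup>2"
  shows "(\<Sum>i\<in>I. \<Sum>a\<in>A. w i a * (\<Sum>s\<in>\<Omega>. x a s * y i s)) \<le> c * (\<alpha> * \<beta>)"
proof -
  obtain h where h: "bij_betw h {0..<card \<Omega>} \<Omega>"
    using ex_bij_betw_nat_finite[OF fin] by blast
  have re: "(\<Sum>k\<in>{0..<card \<Omega>}. f (h k)) = sum f \<Omega>" for f :: "'o \<Rightarrow> real"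
    by (rule sum.reindex_bij_betw[OF h])
  have "(\<Sum>i\<in>I. \<Sum>a\<in>A. w i a * (\<Sum>k\<in>{0..<card \<Omega>}. (x a (h k) / \<alpha>) * (y i (h k) / \<beta>))) \<le> c"
    using P unfolding vector_sum_bound_def
  proof (elim allE impE)
    show "\<forall>a\<in>A. (\<Sum>k\<in>{0..<card \<Omega>}. (x a (h k) / \<alpha>)\<^sup>2) \<le> 1"
      using x al re[of "\<lambda>s. (x _ s / \<alpha>)\<^sup>2"]
      by (auto simp: power_divide sum_divide_distrib[symmetric])
    show "\<forall>i\<in>I. (\<Sum>k\<in>{0..<card \<Omega>}. (y i (h k) / \<beta>)\<^sup>2) \<le> 1"
      using y be re[of "\<lambda>s. (y _ s / \<beta>)\<^sup>2"]
      by (auto simp: power_divide sum_divide_distrib[symmetric])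
  qed simp_all
  also have "(\<Sum>i\<in>I. \<Sum>a\<in>A. w i a * (\<Sum>k\<in>{0..<card \<Omega>}. (x a (h k) / \<alpha>) * (y i (h k) / \<beta>)))
     = (\<Sum>i\<in>I. \<Sum>a\<in>A. w i a * (\<Sum>s\<in>\<Omega>. x a s * y i s)) / (\<alpha> * \<beta>)"
    using re[of "\<lambda>s. x a s * y i s" for a i]
    by (simp add: sum_divide_distrib[symmetric])
  finally show ?thesis
    using al be by (simp add: field_simps)
qed

text \<open>
The level 7 is large enough for the part cut off to be small: by the fourth moment bound its mean
square is at most \<open>3 / 49 \<le> (1 / 4)\<^sup>2\<close>.
\<close>

definition truncate :: "real \<Rightarrow> real" where
  "truncate r = (if \<bar>r\<bar> \<le> 7 then r else 0)"

lemma abs_truncate_le: "\<bar>truncate r\<bar> \<le> 7"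
  by (simp add: truncate_def)

lemma truncate_square_le: "(truncate r)\<^sup>2 \<le> r\<^sup>2"
  by (simp add: truncate_def)

lemma truncate_remainder_square_le: "(r - truncate r)\<^sup>2 \<le> r ^ 4 / 49"
proof (cases "\<bar>r\<bar> \<le> 7")
  case False
  then have "7\<^sup>2 \<le> \<bar>r\<bar>\<^sup>2"
    by (intro power_mono) auto
  then have "49 * r\<^sup>2 \<le> r\<^sup>2 * r\<^sup>2"
    by (intro mult_right_mono) auto
  then show ?thesis
    using False by (simp add: truncate_def power4_eq_xxxx power2_eq_square algebra_simps)
qed (simp add: truncate_def)

lemma vector_sum_bound_trivial: "vector_sum_bound I A w (\<Sum>i\<in>I. \<Sum>a\<in>A. \<bar>w i a\<bar>)"
  unfolding vector_sum_bound_def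
proof (intro allI impI)
  fix D :: "nat set" and x y
  assume x: "\<forall>a\<in>A. (\<Sum>k\<in>D. (x a k)\<^sup>2) \<le> (1::real)"
    and y: "\<forall>i\<in>I. (\<Sum>k\<in>D. (y i k)\<^sup>2) \<le> (1::real)"
  show "(\<Sum>i\<in>I. \<Sum>a\<in>A. w i a * (\<Sum>k\<in>D. x a k * y i k)) \<le> (\<Sum>i\<in>I. \<Sum>a\<in>A. \<bar>w i a\<bar>)"
  proof (intro sum_mono)
    fix i a assume i: "i \<in> I" and a: "a \<in> A"
    have "\<bar>\<Sum>k\<in>D. x a k * y i k\<bar> \<le> (\<Sum>k\<in>D. \<bar>x a k\<bar> * \<bar>y i k\<bar>)"
      using sum_abs[of "\<lambda>k. x a k * y i k" D] by (simp add: abs_mult)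
    also have "\<dots> \<le> L2_set (x a) D * L2_set (y i) D"
      by (rule L2_set_mult_ineq)
    also have "\<dots> \<le> 1 * 1"
      using x y a i by (intro mult_mono) (auto simp: L2_set_def sum_nonneg)
    finally have "\<bar>w i a\<bar> * \<bar>\<Sum>k\<in>D. x a k * y i k\<bar> \<le> \<bar>w i a\<bar> * 1"
      by (intro mult_left_mono) auto
    then show "w i a * (\<Sum>k\<in>D. x a k * y i k) \<le> \<bar>w i a\<bar>"
      by (metis abs_ge_self abs_mult mult.right_neutral order_trans)
  qed
qed

text \<open>
The key step.  Write unit vectors as Rademacher sums and split each of these into its truncation
and a remainder.  Two truncations contribute at most \<open>7 * 7 * N\<close>, since at each point of the cube
they are scalars of modulus at most 7.  The two products that involve a remainder are again values of
the bilinear form at vectors, one of norm at most \<open>1 / 4\<close> and one of norm at most \<open>1\<close>, so the bound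
\<open>c\<close> applies to them and each contributes at most \<open>c / 4\<close>.
\<close>

lemma vector_sum_bound_improve:
  fixes w :: "'i \<Rightarrow> 'a \<Rightarrow> real"
  assumes N: "\<And>\<epsilon>. (\<And>a. a \<in> A \<Longrightarrow> \<bar>\<epsilon> a\<bar> \<le> 1) \<Longrightarrow> (\<Sum>i\<in>I. \<bar>\<Sum>a\<in>A. w i a * \<epsilon> a\<bar>) \<le> N"
    and P: "vector_sum_bound I A w c"
  shows "vector_sum_bound I A w (49 * N + c / 2)"
  unfolding vector_sum_bound_def
proof (intro allI impI)
  fix D :: "nat set" and x :: "'a \<Rightarrow> nat \<Rightarrow> real" and y :: "'i \<Rightarrow> nat \<Rightarrow> real"
  assume D: "finite D"
    and x: "\<forall>a\<in>A. (\<Sum>k\<in>D. (x a k)\<^sup>2) \<le> 1"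
    and y: "\<forall>i\<in>I. (\<Sum>k\<in>D. (y i k)\<^sup>2) \<le> 1"
  define X where "X = (\<lambda>a. rademacher_sum D (x a))"
  define Y where "Y = (\<lambda>i. rademacher_sum D (y i))"
  let ?\<Omega> = "Pow D" and ?n = "2 ^ card D :: real"
  let ?B = "\<lambda>f g. \<Sum>i\<in>I. \<Sum>a\<in>A. w i a * (\<Sum>s\<in>?\<Omega>. f a s * g i s)"
  define U where "U = (\<lambda>a s. truncate (X a s))"
  define V where "V = (\<lambda>i s. truncate (Y i s))"
  have fin: "finite ?\<Omega>" using D by simp
  have moments: "(\<Sum>s\<in>?\<Omega>. (rademacher_sum D z s)\<^sup>2) \<le> ?n"
      "(\<Sum>s\<in>?\<Omega>. (rademacher_sum D z s - truncate (rademacher_sum D z s))\<^sup>2) \<le> ?n / 16"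
    if z: "(\<Sum>k\<in>D. (z k)\<^sup>2) \<le> 1" for z
  proof -
    show "(\<Sum>s\<in>?\<Omega>. (rademacher_sum D z s)\<^sup>2) \<le> ?n"
      using rademacher_sum_inner[OF D, of z z] z by (simp add: power2_eq_square)
    have "(\<Sum>s\<in>?\<Omega>. (rademacher_sum D z s - truncate (rademacher_sum D z s))\<^sup>2)
        \<le> (\<Sum>s\<in>?\<Omega>. rademacher_sum D z s ^ 4 / 49)"
      by (intro sum_mono truncate_remainder_square_le)
    also have "\<dots> = (\<Sum>s\<in>?\<Omega>. rademacher_sum D z s ^ 4) / 49"
      by (simp add: sum_divide_distrib)
    also have "\<dots> \<le> (?n * (3 * (\<Sum>k\<in>D. (z k)\<^sup>2)\<^sup>2)) / 49"
      by (intro divide_right_mono rademacher_sum_fourth_moment D) auto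
    also have "\<dots> \<le> (?n * (3 * 1\<^sup>2)) / 49"
      using z by (intro divide_right_mono mult_left_mono power_mono) (auto simp: sum_nonneg)
    also have "\<dots> \<le> ?n / 16" by simp
    finally show "(\<Sum>s\<in>?\<Omega>. (rademacher_sum D z s - truncate (rademacher_sum D z s))\<^sup>2) \<le> ?n / 16" .
  qed
  have V2: "(\<Sum>s\<in>?\<Omega>. (V i s)\<^sup>2) \<le> ?n" if "i \<in> I" for i
  proof -
    have "(\<Sum>s\<in>?\<Omega>. (V i s)\<^sup>2) \<le> (\<Sum>s\<in>?\<Omega>. (Y i s)\<^sup>2)"
      unfolding V_def by (intro sum_mono truncate_square_le)
    then show ?thesis
      using moments(1)[of "y i"] y that unfolding Y_def by force
  qed
  \<comment> \<open>at each point of the cube the hypothesis on scalars applies to the truncations, scaled by \<open>1 / 7\<close>\<close>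
  have UV: "?B U V \<le> ?n * (49 * N)"
  proof -
    have "?B U V = (\<Sum>s\<in>?\<Omega>. \<Sum>i\<in>I. V i s * (\<Sum>a\<in>A. w i a * U a s))"
      (is "_ = ?R")
    proof -
      have "(\<Sum>a\<in>A. w i a * (\<Sum>s\<in>?\<Omega>. U a s * V i s)) = (\<Sum>s\<in>?\<Omega>. V i s * (\<Sum>a\<in>A. w i a * U a s))" for i
        unfolding sum_distrib_left sum_distrib_right
        by (subst sum.swap) (simp add: mult_ac)
      then have "?B U V = (\<Sum>i\<in>I. \<Sum>s\<in>?\<Omega>. V i s * (\<Sum>a\<in>A. w i a * U a s))"
        by simp
      also have "\<dots> = ?R"
        by (rule sum.swap)
      finally show ?thesis .
    qed
    also have "\<dots> \<le> (\<Sum>s\<in>?\<Omega>. 49 * N)"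
    proof (intro sum_mono)
      fix s
      have "(\<Sum>i\<in>I. V i s * (\<Sum>a\<in>A. w i a * U a s))
          \<le> (\<Sum>i\<in>I. 49 * \<bar>\<Sum>a\<in>A. w i a * (U a s / 7)\<bar>)"
      proof (intro sum_mono)
        fix i
        let ?z = "\<Sum>a\<in>A. w i a * U a s"
        have "V i s * ?z \<le> \<bar>V i s\<bar> * \<bar>?z\<bar>"
          by (metis abs_ge_self abs_mult)
        also have "\<dots> \<le> 7 * \<bar>?z\<bar>"
          unfolding V_def by (intro mult_right_mono abs_truncate_le) auto
        also have "\<dots> = 49 * \<bar>\<Sum>a\<in>A. w i a * (U a s / 7)\<bar>"
          by (simp add: sum_divide_distrib[symmetric])
        finally show "V i s * ?z \<le> 49 * \<bar>\<Sum>a\<in>A. w i a * (U a s / 7)\<bar>" .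
      qed
      also have "\<dots> = 49 * (\<Sum>i\<in>I. \<bar>\<Sum>a\<in>A. w i a * (U a s / 7)\<bar>)"
        by (simp add: sum_distrib_left)
      also have "\<dots> \<le> 49 * N"
        using abs_truncate_le by (intro mult_left_mono N) (auto simp: U_def)
      finally show "(\<Sum>i\<in>I. V i s * (\<Sum>a\<in>A. w i a * U a s)) \<le> 49 * N" .
    qed
    also have "\<dots> = ?n * (49 * N)"
      using D by (simp add: card_Pow)
    finally show ?thesis .
  qed
  have s: "sqrt ?n > 0" "sqrt ?n * sqrt ?n = ?n" by auto
  have RV: "?B (\<lambda>a s. X a s - U a s) V \<le> c * ((sqrt ?n / 4) * sqrt ?n)"
  proof (rule vector_sum_boundD[OF P fin])
    fix a assume "a \<in> A"
    then show "(\<Sum>s\<in>?\<Omega>. (X a s - U a s)\<^sup>2) \<le> (sqrt ?n / 4)\<^sup>2"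
      using moments(2)[of "x a"] x by (simp add: X_def U_def power_divide)
  qed (use V2 s in auto)
  have XR: "?B X (\<lambda>i s. Y i s - V i s) \<le> c * (sqrt ?n * (sqrt ?n / 4))"
  proof (rule vector_sum_boundD[OF P fin])
    fix i assume "i \<in> I"
    then show "(\<Sum>s\<in>?\<Omega>. (Y i s - V i s)\<^sup>2) \<le> (sqrt ?n / 4)\<^sup>2"
      using moments(2)[of "y i"] y by (simp add: Y_def V_def power_divide)
  qed (use moments(1) x s in \<open>auto simp: X_def\<close>)
  have "?n * (\<Sum>i\<in>I. \<Sum>a\<in>A. w i a * (\<Sum>k\<in>D. x a k * y i k)) = ?B X Y"
    unfolding X_def Y_def rademacher_sum_inner[OF D] by (simp add: sum_distrib_left mult_ac)
  also have "\<dots> = ?B U V + ?B (\<lambda>a s. X a s - U a s) V + ?B X (\<lambda>i s. Y i s - V i s)"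
    by (simp add: algebra_simps sum.distrib sum_subtractf)
  also have "\<dots> \<le> ?n * (49 * N) + c * (?n / 4) + c * (?n / 4)"
    using UV RV XR s by simp
  finally have "?n * (\<Sum>i\<in>I. \<Sum>a\<in>A. w i a * (\<Sum>k\<in>D. x a k * y i k)) \<le> ?n * (49 * N + c / 2)"
    by (simp add: algebra_simps)
  then show "(\<Sum>i\<in>I. \<Sum>a\<in>A. w i a * (\<Sum>k\<in>D. x a k * y i k)) \<le> 49 * N + c / 2"
    by simp
qed

text \<open>
Any bound \<open>c\<close> improves to \<open>49 * N + c / 2\<close>.  Starting from the Cauchy-Schwarz bound and iterating,
the bounds converge to the fixed point \<open>98 * N\<close> of this map.
\<close>

lemma grothendieck_inequality:
  fixes w :: "'i \<Rightarrow> 'a \<Rightarrow> real"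
  assumes N: "\<And>\<epsilon>. (\<And>a. a \<in> A \<Longrightarrow> \<bar>\<epsilon> a\<bar> \<le> 1) \<Longrightarrow> (\<Sum>i\<in>I. \<bar>\<Sum>a\<in>A. w i a * \<epsilon> a\<bar>) \<le> N"
  shows "vector_sum_bound I A w (98 * N)"
proof -
  define c where "c = (\<Sum>i\<in>I. \<Sum>a\<in>A. \<bar>w i a\<bar>)"
  have "N \<ge> 0" using N[of "\<lambda>_. 0"] by simp
  have step: "vector_sum_bound I A w (98 * N + c / 2 ^ m)" for m
  proof (induction m)
    case 0
    have "vector_sum_bound I A w c"
      unfolding c_def by (rule vector_sum_bound_trivial)
    then show ?case
      using \<open>N \<ge> 0\<close> unfolding vector_sum_bound_def by (fastforce intro: order_trans)
  next
    case (Suc m)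
    show ?case
      using vector_sum_bound_improve[OF N Suc.IH] by (simp add: field_simps)
  qed
  have lim: "(\<lambda>m. 98 * N + c / 2 ^ m) \<longlonglongrightarrow> 98 * N + 0"
    by (intro tendsto_intros LIMSEQ_divide_realpow_zero) auto
  show ?thesis
    unfolding vector_sum_bound_def
  proof (intro allI impI)
    fix D :: "nat set" and x :: "'a \<Rightarrow> nat \<Rightarrow> real" and y :: "'i \<Rightarrow> nat \<Rightarrow> real"
    assume "finite D" "\<forall>a\<in>A. (\<Sum>k\<in>D. (x a k)\<^sup>2) \<le> 1" "\<forall>i\<in>I. (\<Sum>k\<in>D. (y i k)\<^sup>2) \<le> 1"
    then have "(\<Sum>i\<in>I. \<Sum>a\<in>A. w i a * (\<Sum>k\<in>D. x a k * y i k)) \<le> 98 * N + c / 2 ^ m" for m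
      using step[of m] unfolding vector_sum_bound_def by blast
    then show "(\<Sum>i\<in>I. \<Sum>a\<in>A. w i a * (\<Sum>k\<in>D. x a k * y i k)) \<le> 98 * N"
      using LIMSEQ_le_const[OF lim] by auto
  qed
qed

text \<open>
Testing each vector \<open>\<Sum>a\<in>A. w i a * t a\<close> against its own direction turns the bilinear inequality
into the statement that operators from \<open>\<ell>\<^sub>1\<close> to \<open>\<ell>\<^sub>2\<close>, here given by the images \<open>t a\<close> of the unit
vectors, are absolutely summing.
\<close>

lemma grothendieck_inequality_L2:
  fixes w :: "'i \<Rightarrow> 'a \<Rightarrow> real"
  assumes D: "finite D"
    and N: "\<And>\<epsilon>. (\<And>a. a \<in> A \<Longrightarrow> \<bar>\<epsilon> a\<bar> \<le> 1) \<Longrightarrow> (\<Sum>i\<in>I. \<bar>\<Sum>a\<in>A. w i a * \<epsilon> a\<bar>) \<le> N"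
    and M: "M > 0" and t: "\<And>a. a \<in> A \<Longrightarrow> L2_set (t a) D \<le> M"
  shows "(\<Sum>i\<in>I. L2_set (\<lambda>k. \<Sum>a\<in>A. w i a * t a k) (D :: nat set)) \<le> 98 * N * M"
proof -
  define z where "z = (\<lambda>i k. \<Sum>a\<in>A. w i a * t a k)"
  \<comment> \<open>division by zero makes \<open>y i\<close> vanish when \<open>z i\<close> does, which is the right choice here\<close>
  define y where "y = (\<lambda>i k. z i k / L2_set (z i) D)"
  have sq: "(\<Sum>k\<in>D. (f k)\<^sup>2) = (L2_set f D)\<^sup>2" for f
    by (simp add: L2_set_def sum_nonneg)
  have y1: "(\<Sum>k\<in>D. (y i k)\<^sup>2) \<le> 1\<^sup>2" for i
    by (simp add: y_def power_divide sum_divide_distrib[symmetric] sq)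
  have tM: "(\<Sum>k\<in>D. (t a k)\<^sup>2) \<le> M\<^sup>2" if "a \<in> A" for a
    unfolding sq using t[OF that] by (intro power_mono) auto
  have "(\<Sum>a\<in>A. w i a * (\<Sum>k\<in>D. t a k * y i k)) = L2_set (z i) D" for i
  proof -
    have "(\<Sum>a\<in>A. w i a * (\<Sum>k\<in>D. t a k * y i k)) = (\<Sum>k\<in>D. z i k * y i k)"
      unfolding z_def sum_distrib_left sum_distrib_right
      by (subst sum.swap) (simp add: mult_ac)
    also have "\<dots> = (\<Sum>k\<in>D. (z i k)\<^sup>2) / L2_set (z i) D"
      by (simp add: y_def power2_eq_square sum_divide_distrib)
    also have "\<dots> = L2_set (z i) D"
      unfolding sq by (simp add: power2_eq_square)
    finally show ?thesis .
  qed
  moreover have "(\<Sum>i\<in>I. \<Sum>a\<in>A. w i a * (\<Sum>k\<in>D. t a k * y i k)) \<le> 98 * N * (M * 1)"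
    by (rule vector_sum_boundD[OF grothendieck_inequality[OF N] D M])
       (use tM y1 in auto)
  ultimately show ?thesis by (simp add: z_def)
qed

section \<open>Grothendieck's inequality over the scalar field\<close>

text \<open>
The features of the real and imaginary part that transfer an inequality from the reals to the
scalars.  The constant 2 leaves room for a norm that is only known to be multiplicative.
\<close>

definition real_part_map :: "('k::real_or_complex \<Rightarrow> real) \<Rightarrow> bool" where
  "real_part_map p \<longleftrightarrow> (\<forall>x y. p (x + y) = p x + p y) \<and> (\<forall>r x. p (x * of_real r) = p x * r) \<and>
     (\<forall>x. \<bar>p x\<bar> \<le> 2 * norm x)"

lemma real_part_map_sum:
  assumes "real_part_map p"
  shows "p (\<Sum>a\<in>A. f a) = (\<Sum>a\<in>A. p (f a))"
proof -
  have "p (0 * of_real 0) = p 0 * 0"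
    using assms unfolding real_part_map_def by blast
  then have "p 0 = 0" by simp
  then show ?thesis
    using assms by (induction A rule: infinite_finite_induct) (auto simp: real_part_map_def)
qed

text \<open>
In the complex case, \<open>(a + b j) (a - b j) = a\<^sup>2 + b\<^sup>2\<close> and multiplicativity of the norm bound
\<open>\<bar>a\<bar> + \<bar>b\<bar>\<close> by twice the norm of \<open>a + b j\<close>; this gives both the uniqueness of the parts, hence their
linearity, and their boundedness.
\<close>

lemma real_or_complex_parts:
  "\<exists>re im :: 'k::real_or_complex \<Rightarrow> real. \<exists>j. real_part_map re \<and> real_part_map im \<and> norm j \<le> 1 \<and>
     (\<forall>x. x = of_real (re x) + of_real (im x) * j)"
proof (cases "\<forall>x::'k. \<exists>a. x = a *\<^sub>R 1")
  case True
  then obtain re :: "'k \<Rightarrow> real" where re: "\<And>x. x = of_real (re x)"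
    by (metis of_real_def)
  have inj: "a = b" if "(of_real a :: 'k) = of_real b" for a b
    using that by simp
  have "re (x + y) = re x + re y" "re (x * of_real r) = re x * r" for x y r
    by (rule inj, metis re of_real_add) (rule inj, metis re of_real_mult)
  moreover have "norm x = \<bar>re x\<bar>" for x
    by (metis re norm_of_real)
  ultimately have "real_part_map re"
    by (simp add: real_part_map_def)
  moreover have "real_part_map (\<lambda>_::'k. 0)"
    by (simp add: real_part_map_def)
  ultimately show ?thesis
    using re by (intro exI[of _ re] exI[of _ "\<lambda>_. 0"] exI[of _ 0]) simp
next
  case False
  then obtain j :: 'k where j: "j * j = - 1" and ex: "\<forall>x. \<exists>a b. x = a *\<^sub>R 1 + b *\<^sub>R j"
    using real_or_complex[where ?'a = 'k] by blast
  obtain re im :: "'k \<Rightarrow> real" where parts: "\<And>x. x = of_real (re x) + of_real (im x) * j"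
    using ex by (simp add: scaleR_conv_of_real) metis
  have "(norm j)\<^sup>2 = 1"
    using arg_cong[OF j, of norm] by (simp add: norm_mult power2_eq_square)
  then have nj: "norm j = 1"
    by (metis abs_norm_cancel abs_1 power2_eq_1_iff abs_minus_cancel)
  have bound: "\<bar>a\<bar> + \<bar>b\<bar> \<le> 2 * norm (of_real a + of_real b * j)" for a b
  proof -
    let ?x = "of_real a + of_real b * j" and ?y = "of_real a - of_real b * j"
    have "?x * ?y = of_real a * of_real a - of_real b * of_real b * (j * j)"
      by (simp add: algebra_simps)
    also have "\<dots> = of_real (a\<^sup>2 + b\<^sup>2)"
      unfolding j by (simp add: power2_eq_square)
    finally have "norm ?x * norm ?y = a\<^sup>2 + b\<^sup>2"
      by (metis norm_mult norm_of_real abs_of_nonneg sum_power2_ge_zero)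
    moreover have "norm ?y \<le> \<bar>a\<bar> + \<bar>b\<bar>"
      using norm_triangle_ineq4[of "of_real a" "of_real b * j"] by (simp add: norm_mult nj)
    ultimately have "a\<^sup>2 + b\<^sup>2 \<le> norm ?x * (\<bar>a\<bar> + \<bar>b\<bar>)"
      by (metis mult_left_mono norm_ge_zero)
    moreover have "(\<bar>a\<bar> + \<bar>b\<bar>)\<^sup>2 \<le> 2 * (a\<^sup>2 + b\<^sup>2)"
      using sum_squares_bound[of "\<bar>a\<bar>" "\<bar>b\<bar>"] by (simp add: power2_sum)
    ultimately have "(\<bar>a\<bar> + \<bar>b\<bar>) * (\<bar>a\<bar> + \<bar>b\<bar>) \<le> (2 * norm ?x) * (\<bar>a\<bar> + \<bar>b\<bar>)"
      by (simp add: power2_eq_square)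
    moreover have "0 \<le> norm ?x" by simp
    ultimately show ?thesis
      by (smt (verit) mult_le_cancel_right)
  qed
  have uniq: "a = c \<and> b = d" if "of_real a + of_real b * j = of_real c + of_real d * j" for a b c d
  proof -
    have "of_real (a - c) + of_real (b - d) * j = 0"
      using that by (simp add: algebra_simps)
    then have "\<bar>a - c\<bar> + \<bar>b - d\<bar> \<le> 0"
      using bound[of "a - c" "b - d"] by simp
    then show ?thesis by linarith
  qed
  have add: "re (x + y) = re x + re y \<and> im (x + y) = im x + im y" for x y
  proof (rule uniq)
    have "of_real (re (x + y)) + of_real (im (x + y)) * j = x + y"
      using parts[of "x + y"] by simp
    also have "\<dots> = (of_real (re x) + of_real (im x) * j) + (of_real (re y) + of_real (im y) * j)"
      using parts[of x] parts[of y] by simp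
    finally show "of_real (re (x + y)) + of_real (im (x + y)) * j
        = of_real (re x + re y) + of_real (im x + im y) * j"
      by (simp add: algebra_simps)
  qed
  have mult: "re (x * of_real r) = re x * r \<and> im (x * of_real r) = im x * r" for x r
  proof (rule uniq)
    have "of_real (re (x * of_real r)) + of_real (im (x * of_real r)) * j = x * of_real r"
      using parts[of "x * of_real r"] by simp
    also have "\<dots> = (of_real (re x) + of_real (im x) * j) * of_real r"
      using parts[of x] by simp
    finally show "of_real (re (x * of_real r)) + of_real (im (x * of_real r)) * j
        = of_real (re x * r) + of_real (im x * r) * j"
      by (simp add: algebra_simps)
  qed
  have bd: "\<bar>re x\<bar> + \<bar>im x\<bar> \<le> 2 * norm x" for x
    using bound[of "re x" "im x"] parts[of x] by simp
  have "\<bar>re x\<bar> \<le> 2 * norm x" "\<bar>im x\<bar> \<le> 2 * norm x" for x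
    using bd[of x] by linarith+
  then have "real_part_map re" "real_part_map im"
    using add mult by (simp_all add: real_part_map_def)
  then show ?thesis
    using nj parts by (intro exI[of _ re] exI[of _ im] exI[of _ j]) simp
qed

lemma lp_norm_1: "lp_norm 1 m x = (\<Sum>i<m. norm (x i))"
  by (simp add: lp_norm_def sum_nonneg)

lemma lp_norm_2: "lp_norm 2 m x = L2_set (\<lambda>i. norm (x i)) {..<m}"
  by (simp add: lp_norm_def L2_set_def powr_half_sqrt sum_nonneg)

text \<open>
Splitting \<open>w\<close> and \<open>t\<close> into parts yields four real instances, each with \<open>N\<close> and \<open>M\<close> doubled:
\<open>1568 = 4 * 98 * 2 * 2\<close>.
\<close>

lemma scalar_grothendieck_inequality:
  fixes w :: "'i \<Rightarrow> 'a \<Rightarrow> 'k::real_or_complex"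
  assumes N: "\<And>\<epsilon>. (\<And>a. a \<in> A \<Longrightarrow> \<bar>\<epsilon> a\<bar> \<le> 1) \<Longrightarrow> (\<Sum>i\<in>I. norm (\<Sum>a\<in>A. w i a * of_real (\<epsilon> a))) \<le> N"
    and M: "M > 0" and t: "\<And>a. a \<in> A \<Longrightarrow> lp_norm 2 d (t a) \<le> M"
  shows "(\<Sum>i\<in>I. lp_norm 2 d (\<lambda>k. \<Sum>a\<in>A. w i a * t a k)) \<le> 1568 * N * M"
proof -
  obtain re im :: "'k \<Rightarrow> real" and j :: 'k where re: "real_part_map re" and im: "real_part_map im"
    and j: "norm j \<le> 1" and parts: "\<And>x. x = of_real (re x) + of_real (im x) * j"
    using real_or_complex_parts by blast
  define Z where "Z = (\<lambda>p q i k. \<Sum>a\<in>A. p (w i a) * q (t a k) :: real)"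
  have part: "(\<Sum>i\<in>I. L2_set (Z p q i) {..<d}) \<le> 392 * N * M"
    if p: "real_part_map p" and q: "real_part_map q" for p q
  proof -
    have "(\<Sum>i\<in>I. L2_set (\<lambda>k. \<Sum>a\<in>A. p (w i a) * q (t a k)) {..<d}) \<le> 98 * (2 * N) * (2 * M)"
    proof (rule grothendieck_inequality_L2)
      fix \<epsilon> :: "'a \<Rightarrow> real" assume \<epsilon>: "\<And>a. a \<in> A \<Longrightarrow> \<bar>\<epsilon> a\<bar> \<le> 1"
      have "(\<Sum>i\<in>I. \<bar>\<Sum>a\<in>A. p (w i a) * \<epsilon> a\<bar>) = (\<Sum>i\<in>I. \<bar>p (\<Sum>a\<in>A. w i a * of_real (\<epsilon> a))\<bar>)"
        using p by (simp add: real_part_map_sum[OF p]) (simp add: real_part_map_def)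
      also have "\<dots> \<le> (\<Sum>i\<in>I. 2 * norm (\<Sum>a\<in>A. w i a * of_real (\<epsilon> a)))"
        using p by (intro sum_mono) (simp add: real_part_map_def)
      also have "\<dots> \<le> 2 * N"
        using N[OF \<epsilon>] by (simp add: sum_distrib_left[symmetric])
      finally show "(\<Sum>i\<in>I. \<bar>\<Sum>a\<in>A. p (w i a) * \<epsilon> a\<bar>) \<le> 2 * N" .
    next
      fix a assume a: "a \<in> A"
      have "L2_set (\<lambda>k. q (t a k)) {..<d} = L2_set (\<lambda>k. \<bar>q (t a k)\<bar>) {..<d}"
        by (simp add: L2_set_def)
      also have "\<dots> \<le> L2_set (\<lambda>k. 2 * norm (t a k)) {..<d}"
        using q by (intro L2_set_mono) (auto simp: real_part_map_def)
      also have "\<dots> = 2 * lp_norm 2 d (t a)"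
        by (simp add: lp_norm_2 L2_set_right_distrib)
      finally show "L2_set (\<lambda>k. q (t a k)) {..<d} \<le> 2 * M"
        using t[OF a] by simp
    qed (use M in auto)
    then show ?thesis
      by (simp add: Z_def)
  qed
  have pointwise: "norm (\<Sum>a\<in>A. w i a * t a k) \<le>
      (\<bar>Z re re i k\<bar> + \<bar>Z re im i k\<bar>) + (\<bar>Z im re i k\<bar> + \<bar>Z im im i k\<bar>)" for i k
  proof -
    have "w i a * t a k = of_real (re (w i a) * re (t a k)) + of_real (re (w i a) * im (t a k)) * j
        + of_real (im (w i a) * re (t a k)) * j + of_real (im (w i a) * im (t a k)) * (j * j)" for a
      by (subst parts[of "w i a"], subst parts[of "t a k"]) (simp add: algebra_simps)
    then have "(\<Sum>a\<in>A. w i a * t a k) = of_real (Z re re i k) + of_real (Z re im i k) * j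
        + of_real (Z im re i k) * j + of_real (Z im im i k) * (j * j)"
      by (simp add: Z_def sum.distrib sum_distrib_right)
    moreover have "norm (of_real r * j) \<le> \<bar>r\<bar>" "norm (of_real r * (j * j)) \<le> \<bar>r\<bar>" for r :: real
      using j by (auto simp: norm_mult mult_le_one intro!: mult_left_le)
    ultimately show ?thesis
      by (smt (verit) norm_triangle_ineq norm_of_real)
  qed
  have four: "lp_norm 2 d (\<lambda>k. \<Sum>a\<in>A. w i a * t a k) \<le>
     (L2_set (Z re re i) {..<d} + L2_set (Z re im i) {..<d}) +
     (L2_set (Z im re i) {..<d} + L2_set (Z im im i) {..<d})" for i
  proof -
    have abs: "L2_set (\<lambda>k. \<bar>f k\<bar>) {..<d} = L2_set f {..<d}" for f
      by (simp add: L2_set_def)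
    have "lp_norm 2 d (\<lambda>k. \<Sum>a\<in>A. w i a * t a k) \<le>
       L2_set (\<lambda>k. (\<bar>Z re re i k\<bar> + \<bar>Z re im i k\<bar>) + (\<bar>Z im re i k\<bar> + \<bar>Z im im i k\<bar>)) {..<d}"
      unfolding lp_norm_2 by (intro L2_set_mono pointwise) auto
    also have "\<dots> \<le> L2_set (\<lambda>k. \<bar>Z re re i k\<bar> + \<bar>Z re im i k\<bar>) {..<d}
        + L2_set (\<lambda>k. \<bar>Z im re i k\<bar> + \<bar>Z im im i k\<bar>) {..<d}"
      by (rule L2_set_triangle_ineq)
    also have "\<dots> \<le> (L2_set (\<lambda>k. \<bar>Z re re i k\<bar>) {..<d} + L2_set (\<lambda>k. \<bar>Z re im i k\<bar>) {..<d})
        + (L2_set (\<lambda>k. \<bar>Z im re i k\<bar>) {..<d} + L2_set (\<lambda>k. \<bar>Z im im i k\<bar>) {..<d})"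
      by (intro add_mono L2_set_triangle_ineq)
    finally show ?thesis
      by (simp add: abs)
  qed
  have "(\<Sum>i\<in>I. lp_norm 2 d (\<lambda>k. \<Sum>a\<in>A. w i a * t a k)) \<le>
     ((\<Sum>i\<in>I. L2_set (Z re re i) {..<d}) + (\<Sum>i\<in>I. L2_set (Z re im i) {..<d})) +
     ((\<Sum>i\<in>I. L2_set (Z im re i) {..<d}) + (\<Sum>i\<in>I. L2_set (Z im im i) {..<d}))"
    unfolding sum.distrib[symmetric] by (intro sum_mono four)
  also have "\<dots> \<le> (392 * N * M + 392 * N * M) + (392 * N * M + 392 * N * M)"
    by (intro add_mono part re im)
  finally show ?thesis by (simp add: algebra_simps)
qed

section \<open>Coordinates in finite-dimensional subspaces of script-L spaces\<close>

lemma lp_norm_mult: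
  fixes x :: "nat \<Rightarrow> 'k::real_or_complex"
  assumes "p > 0"
  shows "lp_norm p m (\<lambda>i. c * x i) = norm c * lp_norm p m x"
  using assms
  by (simp add: lp_norm_def norm_mult powr_mult sum_distrib_left[symmetric] sum_nonneg powr_powr)

lemma map_norm_upper:
  fixes N :: "'c \<Rightarrow> real" and M :: "'d \<Rightarrow> real"
  assumes bd: "map_bounded F N M v" and N0: "\<And>z. z \<in> F \<Longrightarrow> N z \<ge> 0" and x: "x \<in> F" "N x \<le> 1"
  shows "M (v x) \<le> map_norm F N M v"
proof -
  obtain C where C: "\<forall>x\<in>F. M (v x) \<le> C * N x"
    using bd unfolding map_bounded_def by blast
  have "M (v z) \<le> \<bar>C\<bar>" if "z \<in> F" "N z \<le> 1" for z
  proof -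
    have "M (v z) \<le> \<bar>C\<bar> * N z"
      using C N0 that by (meson abs_ge_self mult_right_mono order_trans)
    also have "\<dots> \<le> \<bar>C\<bar>"
      using that N0 by (intro mult_left_le) auto
    finally show ?thesis .
  qed
  then have "bdd_above ((\<lambda>x. M (v x)) ` {x \<in> F. N x \<le> 1})"
    by (intro bdd_aboveI2[of _ _ "\<bar>C\<bar>"]) auto
  then show ?thesis
    unfolding map_norm_def using x by (intro cSUP_upper) auto
qed

text \<open>
The maps \<open>f r\<close> provide the multiples of \<open>x\<close>, so that the inequality holds for operators between
spaces whose norms are mere functions on carriers.
\<close>

lemma map_norm_bound:
  fixes N :: "'c \<Rightarrow> real" and M :: "'d \<Rightarrow> real"
  assumes bd: "map_bounded F N M v" and N0: "\<And>z. z \<in> F \<Longrightarrow> N z \<ge> 0" and x: "x \<in> F"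
    and sc: "\<And>r. r > 0 \<Longrightarrow> f r \<in> F \<and> N (f r) = r * N x \<and> M (v (f r)) = r * M (v x)"
  shows "M (v x) \<le> map_norm F N M v * N x"
proof (cases "N x = 0")
  case True
  then show ?thesis
    using bd x unfolding map_bounded_def by fastforce
next
  case False
  then have pos: "N x > 0" using N0[OF x] by simp
  let ?y = "f (1 / N x)"
  have y: "?y \<in> F" "N ?y = 1" "M (v ?y) = M (v x) / N x"
    using sc[of "1 / N x"] pos by auto
  then have "M (v x) / N x \<le> map_norm F N M v"
    using map_norm_upper[OF bd N0, of ?y] by simp
  then show ?thesis
    using pos by (simp add: field_simps)
qed

context normed_space_over
begin

text \<open>
An isomorphism \<open>F \<rightarrow> \<ell>\<^sub>p\<close> in coordinates, with its norm scaled to at most 1, so that the distance to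
\<open>\<ell>\<^sub>p\<close> is borne by the inverse alone.  The \<open>e k\<close> are the preimages of the unit vectors.
\<close>

definition lp_coordinates ::
  "real \<Rightarrow> real \<Rightarrow> 'a set \<Rightarrow> nat \<Rightarrow> (nat \<Rightarrow> 'a) \<Rightarrow> ('a \<Rightarrow> nat \<Rightarrow> 'k) \<Rightarrow> bool" where
  "lp_coordinates p l F m e c \<longleftrightarrow>
     (\<forall>k<m. e k \<in> F \<and> norm (e k) \<le> l) \<and>
     (\<forall>x\<in>F. \<forall>y\<in>F. \<forall>k. c (x + y) k = c x k + c y k) \<and>
     (\<forall>r. \<forall>x\<in>F. \<forall>k. c (scale r x) k = r * c x k) \<and>
     (\<forall>x\<in>F. x = (\<Sum>k<m. scale (c x k) (e k))) \<and>
     (\<forall>x\<in>F. lp_norm p m (c x) \<le> norm x \<and> norm x \<le> l * lp_norm p m (c x))"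

text \<open>
Divide \<open>v\<close> by its norm \<open>\<alpha>\<close> and multiply its inverse by \<open>\<alpha>\<close>; the product of the norms does not
change.  If \<open>\<alpha> = 0\<close> then \<open>F\<close> is trivial, there are no unit vectors to map back, and the factor 1 serves.
\<close>

lemma lp_coordinates_of_isomorphism:
  assumes p: "p > 0" and F: "subspace F" and iso: "lp_isomorphism p F v"
    and l: "map_norm F norm (lp_norm p (dim F)) v *
      map_norm (lp_carrier (dim F)) (lp_norm p (dim F)) norm (inv_into F v) \<le> l"
  shows "\<exists>m e c. lp_coordinates p l F m e c"
proof -
  define m where "m = dim F"
  define g where "g = inv_into F v"
  define \<alpha> where "\<alpha> = map_norm F norm (lp_norm p m) v"
  define \<beta> where "\<beta> = map_norm (lp_carrier m) (lp_norm p m) norm g"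
  define \<delta> :: "nat \<Rightarrow> nat \<Rightarrow> 'k" where "\<delta> = (\<lambda>k i. if i = k then 1 else 0)"
  define b where "b = (if \<alpha> = 0 then 1 else \<alpha>)"
  have bij: "bij_betw v F (lp_carrier m)"
    and add: "\<And>x y. x \<in> F \<Longrightarrow> y \<in> F \<Longrightarrow> v (x + y) = (\<lambda>i. v x i + v y i)"
    and hom: "\<And>r x. x \<in> F \<Longrightarrow> v (scale r x) = (\<lambda>i. r * v x i)"
    and bv: "map_bounded F norm (lp_norm p m) v"
    and bg: "map_bounded (lp_carrier m) (lp_norm p m) norm g"
    using iso by (auto simp: lp_isomorphism_def m_def g_def)
  have inj: "inj_on v F" using bij by (rule bij_betw_imp_inj_on)
  have gF: "g y \<in> F" and vg: "v (g y) = y" if "y \<in> lp_carrier m" for y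
    using bij that by (auto simp: g_def bij_betw_def inv_into_into f_inv_into_f)
  have gv: "g (v x) = x" if "x \<in> F" for x
    using inj that by (simp add: g_def)
  have vF: "v x \<in> lp_carrier m" if "x \<in> F" for x
    using bij that by (auto simp: bij_betw_def)
  have lp0: "lp_norm p m y \<ge> 0" for y :: "nat \<Rightarrow> 'k"
    by (simp add: lp_norm_def)
  have sF: "scale r x \<in> F" if "x \<in> F" for r x
    using F that by (rule subspace_scale)
  have v_le: "lp_norm p m (v x) \<le> \<alpha> * norm x" if x: "x \<in> F" for x
    unfolding \<alpha>_def
  proof (rule map_norm_bound[OF bv _ x, where f = "\<lambda>r. scale (of_real r) x"])
    fix r :: real assume "r > 0"
    then show "scale (of_real r) x \<in> F \<and> norm (scale (of_real r) x) = r * norm x \<and>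
        lp_norm p m (v (scale (of_real r) x)) = r * lp_norm p m (v x)"
      using x p by (simp add: sF hom norm_scale lp_norm_mult)
  qed simp
  have g_le: "norm (g y) \<le> \<beta> * lp_norm p m y" if y: "y \<in> lp_carrier m" for y
    unfolding \<beta>_def
  proof (rule map_norm_bound[OF bg lp0 y, where f = "\<lambda>r i. of_real r * y i"])
    fix r :: real assume r: "r > 0"
    have "g (\<lambda>i. of_real r * y i) = g (v (scale (of_real r) (g y)))"
      using y by (simp add: hom gF vg)
    also have "\<dots> = scale (of_real r) (g y)"
      using y by (intro gv sF gF)
    finally show "(\<lambda>i. of_real r * y i) \<in> lp_carrier m \<and> lp_norm p m (\<lambda>i. of_real r * y i) = r * lp_norm p m y
        \<and> norm (g (\<lambda>i. of_real r * y i)) = r * norm (g y)"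
      using r p y by (simp add: norm_scale lp_norm_mult lp_carrier_def)
  qed
  have "norm (0::'a) \<le> 1" "0 \<in> F" using subspace_0[OF F] by auto
  then have \<alpha>0: "\<alpha> \<ge> 0"
    using map_norm_upper[OF bv, of 0] lp0[of "v 0"] by (simp add: \<alpha>_def)
  then have b0: "b > 0" by (simp add: b_def)
  have ab: "\<alpha> \<noteq> 0 \<Longrightarrow> \<beta> * b \<le> l"
    using l by (simp add: b_def \<alpha>_def \<beta>_def m_def g_def mult.commute)
  have \<delta>: "\<delta> k \<in> lp_carrier m" "lp_norm p m (\<delta> k) = 1" if "k < m" for k
  proof -
    show "\<delta> k \<in> lp_carrier m" using that by (auto simp: \<delta>_def lp_carrier_def)
    have "norm (\<delta> k i) powr p = (if i = k then 1 else 0)" for i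
      by (simp add: \<delta>_def)
    then show "lp_norm p m (\<delta> k) = 1"
      using that by (simp add: lp_norm_def)
  qed
  define c where "c = (\<lambda>x k. of_real (1 / b) * v x k)"
  define e where "e = (\<lambda>k. scale (of_real b) (g (\<delta> k)))"
  have eF: "e k \<in> F" if "k < m" for k
    using that by (simp add: e_def sF gF \<delta>)
  have lpc: "lp_norm p m (c x) = lp_norm p m (v x) / b" for x
    unfolding c_def lp_norm_mult[OF p] using b0 by (simp add: norm_divide)
  have sum_F: "(\<Sum>k<j. scale (a k) (e k)) \<in> F \<and> v (\<Sum>k<j. scale (a k) (e k)) = (\<lambda>i. \<Sum>k<j. a k * v (e k) i)"
    if "j \<le> m" for a j
    using that
  proof (induction j)
    case 0
    have "v (scale 0 0) = (\<lambda>i. 0 * v 0 i)" using subspace_0[OF F] by (rule hom)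
    then show ?case using subspace_0[OF F] by simp
  next
    case (Suc j)
    then show ?case
      using eF[of j] by (simp add: add hom sF subspace_add[OF F])
  qed
  show ?thesis
    unfolding lp_coordinates_def
  proof (rule exI[of _ m], rule exI[of _ e], rule exI[of _ c], intro conjI ballI allI impI)
    fix k assume k: "k < m"
    show "e k \<in> F" using eF[OF k] .
    have "\<alpha> \<noteq> 0"
      using v_le[OF gF[OF \<delta>(1)[OF k]]] \<delta>[OF k] vg by fastforce
    moreover have "norm (e k) \<le> b * (\<beta> * 1)"
      using b0 g_le[OF \<delta>(1)[OF k]] \<delta>[OF k] by (simp add: e_def norm_scale)
    ultimately show "norm (e k) \<le> l"
      using ab by (simp add: mult.commute)
  next
    fix x y k assume "x \<in> F" "y \<in> F"
    then show "c (x + y) k = c x k + c y k"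
      by (simp add: c_def add algebra_simps add_divide_distrib)
  next
    fix r x k assume "x \<in> F"
    then show "c (scale r x) k = r * c x k"
      by (simp add: c_def hom)
  next
    fix x assume x: "x \<in> F"
    have "v (e k) i = of_real b * \<delta> k i" if "k < m" for k i
      using that by (simp add: e_def hom gF vg \<delta>)
    then have "(\<Sum>k<m. c x k * v (e k) i) = (\<Sum>k<m. if i = k then v x k else 0)" for i
      using b0 by (intro sum.cong) (auto simp: c_def \<delta>_def)
    also have "(\<Sum>k<m. if i = k then v x k else 0) = v x i" for i
      using vF[OF x] by (auto simp: lp_carrier_def)
    finally have "v (\<Sum>k<m. scale (c x k) (e k)) = v x"
      using sum_F[of m "c x"] by simp
    then show "x = (\<Sum>k<m. scale (c x k) (e k))"
      using inj sum_F[of m "c x"] x by (metis inj_onD order_refl)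
    show "lp_norm p m (c x) \<le> norm x"
      using v_le[OF x] b0 \<alpha>0 lp0[of "v x"]
      by (cases "\<alpha> = 0") (simp_all add: lpc b_def field_simps)
    have "norm x \<le> \<beta> * lp_norm p m (v x)"
      using g_le[OF vF[OF x]] gv[OF x] by simp
    also have "\<dots> \<le> l * lp_norm p m (c x)"
    proof (cases "\<alpha> = 0")
      case True
      then have "lp_norm p m (v x) = 0" using v_le[OF x] lp0[of "v x"] by simp
      then show ?thesis by (simp add: lpc)
    next
      case False
      have "\<beta> * lp_norm p m (v x) = (\<beta> * b) * lp_norm p m (c x)"
        using b0 by (simp add: lpc)
      also have "\<dots> \<le> l * lp_norm p m (c x)"
        using ab[OF False] lp0 by (rule mult_right_mono)
      finally show ?thesis .
    qed
    finally show "norm x \<le> l * lp_norm p m (c x)" .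
  qed
qed

lemma script_L_space_coordinates:
  assumes "p > 0" and "script_L_space p X"
  obtains l where "l \<ge> 1"
    and "\<And>S. finite S \<Longrightarrow> span S \<subseteq> X \<Longrightarrow>
      \<exists>F m e c. S \<subseteq> F \<and> F \<subseteq> X \<and> subspace F \<and> lp_coordinates p l F m e c"
proof -
  obtain l where "l \<ge> 1" and l: "\<And>E. finite_dimensional_subspace E \<Longrightarrow> E \<subseteq> X \<Longrightarrow>
        (\<exists>F v. finite_dimensional_subspace F \<and> E \<subseteq> F \<and> F \<subseteq> X \<and> lp_isomorphism p F v \<and>
           map_norm F norm (lp_norm p (dim F)) v *
           map_norm (lp_carrier (dim F)) (lp_norm p (dim F)) norm (inv_into F v) \<le> l)"
    using assms(2) unfolding script_L_space_def by metis
  show thesis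
  proof (rule that[OF \<open>l \<ge> 1\<close>])
    fix S assume S: "finite S" "span S \<subseteq> X"
    then have "finite_dimensional_subspace (span S)"
      unfolding finite_dimensional_subspace_def by blast
    then obtain F v where F: "finite_dimensional_subspace F" "span S \<subseteq> F" "F \<subseteq> X" "lp_isomorphism p F v"
           "map_norm F norm (lp_norm p (dim F)) v *
           map_norm (lp_carrier (dim F)) (lp_norm p (dim F)) norm (inv_into F v) \<le> l"
      using l S(2) by metis
    have sF: "subspace F"
      using F(1) unfolding finite_dimensional_subspace_def by auto
    show "\<exists>F m e c. S \<subseteq> F \<and> F \<subseteq> X \<and> subspace F \<and> lp_coordinates p l F m e c"
      using lp_coordinates_of_isomorphism[OF assms(1) sF F(4,5)] F(2,3) sF span_superset[of S]
      by blast
  qed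
qed

end

section \<open>Multilinear maps on products of finite-dimensional subspaces\<close>

text \<open>
Multilinearity separated from boundedness, so that it can be restricted to products of subspaces.
\<close>

definition multilinear_on ::
  "('k::real_or_complex \<Rightarrow> 'a::real_normed_vector \<Rightarrow> 'a) \<Rightarrow> ('k \<Rightarrow> 'b::real_normed_vector \<Rightarrow> 'b) \<Rightarrow>
   nat \<Rightarrow> (nat \<Rightarrow> 'a set) \<Rightarrow> ((nat \<Rightarrow> 'a) \<Rightarrow> 'b) \<Rightarrow> bool" where
  "multilinear_on sX sY n X T \<longleftrightarrow>
     (\<forall>u\<in>Pi\<^sub>E {1..n} X. \<forall>i\<in>{1..n}. \<forall>x\<in>X i. \<forall>y\<in>X i.
        T (u(i := x + y)) = T (u(i := x)) + T (u(i := y))) \<and>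
     (\<forall>u\<in>Pi\<^sub>E {1..n} X. \<forall>i\<in>{1..n}. \<forall>x\<in>X i. \<forall>c.
        T (u(i := sX c x)) = sY c (T (u(i := x))))"

lemma bounded_multilinear_iff:
  "T \<in> bounded_multilinear sX sY n X \<longleftrightarrow> multilinear_on sX sY n X T \<and>
     (\<exists>C. \<forall>u\<in>Pi\<^sub>E {1..n} X. norm (T u) \<le> C * (\<Prod>i\<in>{1..n}. norm (u i)))"
  by (simp add: bounded_multilinear_def multilinear_on_def)

lemma multilinear_on_subset:
  assumes "multilinear_on sX sY n X T" and F: "\<And>j. j \<in> {1..n} \<Longrightarrow> F j \<subseteq> X j"
  shows "multilinear_on sX sY n F T"
proof -
  have sub: "x \<in> Pi\<^sub>E {1..n} X" if "x \<in> Pi\<^sub>E {1..n} F" for x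
    using PiE_mono[OF F] that by (rule subsetD)
  show ?thesis
    unfolding multilinear_on_def
  proof (intro conjI ballI allI)
    fix u i x y assume "u \<in> Pi\<^sub>E {1..n} F" "i \<in> {1..n}" "x \<in> F i" "y \<in> F i"
    then have "u \<in> Pi\<^sub>E {1..n} X" "i \<in> {1..n}" "x \<in> X i" "y \<in> X i"
      using sub F by blast+
    then show "T (u(i := x + y)) = T (u(i := x)) + T (u(i := y))"
      using assms(1) unfolding multilinear_on_def by blast
  next
    fix u i x c assume "u \<in> Pi\<^sub>E {1..n} F" "i \<in> {1..n}" "x \<in> F i"
    then have "u \<in> Pi\<^sub>E {1..n} X" "i \<in> {1..n}" "x \<in> X i"
      using sub F by blast+
    then show "T (u(i := sX c x)) = sY c (T (u(i := x)))"
      using assms(1) unfolding multilinear_on_def by blast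
  qed
qed

lemma sum_PiE_insert:
  fixes f :: "('i \<Rightarrow> 'c) \<Rightarrow> 'd::comm_monoid_add"
  assumes "i \<notin> J"
  shows "(\<Sum>a\<in>Pi\<^sub>E (insert i J) S. f a) = (\<Sum>a\<in>Pi\<^sub>E J S. \<Sum>k\<in>S i. f (a(i := k)))"
proof -
  have inj: "inj_on (\<lambda>(y, g). g(i := y)) (S i \<times> Pi\<^sub>E J S)"
    using assms by (rule inj_combinator)
  have "(\<Sum>a\<in>Pi\<^sub>E (insert i J) S. f a) = (\<Sum>(k, a)\<in>S i \<times> Pi\<^sub>E J S. f (a(i := k)))"
    unfolding PiE_insert_eq sum.reindex[OF inj] by (simp add: case_prod_unfold)
  also have "\<dots> = (\<Sum>a\<in>Pi\<^sub>E J S. \<Sum>k\<in>S i. f (a(i := k)))"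
    unfolding sum.cartesian_product[symmetric] by (rule sum.swap)
  finally show ?thesis .
qed

lemma prod_sum_PiE:
  fixes f :: "'i \<Rightarrow> 'c \<Rightarrow> 'd::comm_semiring_1"
  assumes "finite J"
  shows "(\<Sum>a\<in>Pi\<^sub>E J S. \<Prod>j\<in>J. f j (a j)) = (\<Prod>j\<in>J. \<Sum>k\<in>S j. f j k)"
  using assms
proof (induction J rule: finite_induct)
  case empty
  then show ?case by simp
next
  case (insert i J)
  have "(\<Prod>j\<in>insert i J. f j ((a(i := k)) j)) = f i k * (\<Prod>j\<in>J. f j (a j))" for a k
    using insert.hyps by (simp, intro arg_cong2[of _ _ _ _ "(*)"] prod.cong) auto
  then show ?case
    using insert by (simp add: sum_PiE_insert sum_distrib_right[symmetric] sum_distrib_left[symmetric])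
qed

lemma multilinear_on_sum:
  fixes sX :: "'k::real_or_complex \<Rightarrow> 'a::real_normed_vector \<Rightarrow> 'a"
    and sY :: "'k \<Rightarrow> 'b::real_normed_vector \<Rightarrow> 'b"
    and m :: nat
  assumes X: "normed_space_over sX" and Y: "normed_space_over sY"
    and sub: "module.subspace sX (F i)"
    and T: "multilinear_on sX sY n F T"
    and u: "u \<in> Pi\<^sub>E {1..n} F" and i: "i \<in> {1..n}"
    and e: "\<And>k. k < m \<Longrightarrow> e k \<in> F i"
  shows "T (u(i := \<Sum>k<m. sX (c k) (e k))) = (\<Sum>k<m. sY (c k) (T (u(i := e k))))"
proof -
  interpret X: normed_space_over sX by fact
  interpret Y: normed_space_over sY by fact
  have "(\<Sum>k<j. sX (c k) (e k)) \<in> F i \<and>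
      T (u(i := \<Sum>k<j. sX (c k) (e k))) = (\<Sum>k<j. sY (c k) (T (u(i := e k))))" if "j \<le> m" for j
    using that
  proof (induction j)
    case 0
    have "0 \<in> F i" using sub by (rule X.subspace_0)
    moreover from this have "T (u(i := sX 0 0)) = sY 0 (T (u(i := 0)))"
      using T u i unfolding multilinear_on_def by blast
    ultimately have "0 \<in> F i \<and> T (u(i := 0)) = 0" by simp
    then show ?case by (simp del: fun_upd_apply)
  next
    case (Suc j)
    let ?s = "\<Sum>k<j. sX (c k) (e k)"
    have s: "?s \<in> F i" and ej: "e j \<in> F i" and eq: "T (u(i := ?s)) = (\<Sum>k<j. sY (c k) (T (u(i := e k))))"
      using Suc e[of j] by (auto simp del: fun_upd_apply)
    have sej: "sX (c j) (e j) \<in> F i" using sub ej by (rule X.subspace_scale)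
    have "T (u(i := ?s + sX (c j) (e j))) = T (u(i := ?s)) + T (u(i := sX (c j) (e j)))"
      using T u i s sej unfolding multilinear_on_def by blast
    moreover have "T (u(i := sX (c j) (e j))) = sY (c j) (T (u(i := e j)))"
      using T u i ej unfolding multilinear_on_def by blast
    ultimately show ?case
      using X.subspace_add[OF sub s sej] eq by (simp del: fun_upd_apply)
  qed
  then show ?thesis by blast
qed

text \<open>
Expanding the arguments one at a time, the induction runs over the set \<open>J\<close> of arguments already
expanded.
\<close>

lemma multilinear_on_expansion:
  fixes sX :: "'k::real_or_complex \<Rightarrow> 'a::real_normed_vector \<Rightarrow> 'a"
    and sY :: "'k \<Rightarrow> 'b::real_normed_vector \<Rightarrow> 'b"
    and m :: "nat \<Rightarrow> nat"
  assumes X: "normed_space_over sX" and Y: "normed_space_over sY"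
    and sub: "\<And>j. j \<in> {1..n} \<Longrightarrow> module.subspace sX (F j)"
    and T: "multilinear_on sX sY n F T"
    and u: "u \<in> Pi\<^sub>E {1..n} F"
    and e: "\<And>j k. j \<in> {1..n} \<Longrightarrow> k < m j \<Longrightarrow> e j k \<in> F j"
    and c: "\<And>j. j \<in> {1..n} \<Longrightarrow> u j = (\<Sum>k<m j. sX (c j k) (e j k))"
  shows "T u = (\<Sum>a\<in>Pi\<^sub>E {1..n} (\<lambda>j. {..<m j}).
      sY (\<Prod>j\<in>{1..n}. c j (a j)) (T (\<lambda>j\<in>{1..n}. e j (a j))))"
proof -
  interpret X: normed_space_over sX by fact
  interpret Y: normed_space_over sY by fact
  let ?S = "\<lambda>j. {..<m j}"
  have "T u = (\<Sum>a\<in>Pi\<^sub>E J ?S. sY (\<Prod>j\<in>J. c j (a j)) (T (\<lambda>j. if j \<in> J then e j (a j) else u j)))"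
    if "J \<subseteq> {1..n}" for J
  proof -
    have "finite J" using that finite_subset by blast
    then show ?thesis using that
    proof (induction J rule: finite_induct)
      case empty
      then show ?case by simp
    next
      case (insert i J)
      have i: "i \<in> {1..n}" using insert.prems by simp
      let ?w = "\<lambda>a j. if j \<in> J then e j (a j) else u j"
      have "sY (\<Prod>j\<in>J. c j (a j)) (T (?w a)) = (\<Sum>k<m i. sY (\<Prod>j\<in>insert i J. c j ((a(i := k)) j))
          (T (\<lambda>j. if j \<in> insert i J then e j ((a(i := k)) j) else u j)))"
        if a: "a \<in> Pi\<^sub>E J ?S" for a
      proof -
        have w: "?w a \<in> Pi\<^sub>E {1..n} F"
          using u e a insert.prems by (fastforce simp: PiE_iff extensional_def)
        have "?w a = (?w a)(i := u i)"
          using insert.hyps by auto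
        then have "T (?w a) = T ((?w a)(i := \<Sum>k<m i. sX (c i k) (e i k)))"
          using c[OF i] by simp
        also have "\<dots> = (\<Sum>k<m i. sY (c i k) (T ((?w a)(i := e i k))))"
          by (rule multilinear_on_sum[OF X Y sub T w]) (use i e in auto)
        finally have "sY (\<Prod>j\<in>J. c j (a j)) (T (?w a))
            = (\<Sum>k<m i. sY (c i k * (\<Prod>j\<in>J. c j (a j))) (T ((?w a)(i := e i k))))"
          by (simp add: Y.scale_sum_right mult.commute)
        also have "\<dots> = (\<Sum>k<m i. sY (\<Prod>j\<in>insert i J. c j ((a(i := k)) j))
          (T (\<lambda>j. if j \<in> insert i J then e j ((a(i := k)) j) else u j)))"
        proof (intro sum.cong refl)
          fix k
          have "(\<Prod>j\<in>J. c j (a j)) = (\<Prod>j\<in>J. c j ((a(i := k)) j))"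
            using insert.hyps by (intro prod.cong) auto
          then have "c i k * (\<Prod>j\<in>J. c j (a j)) = (\<Prod>j\<in>insert i J. c j ((a(i := k)) j))"
            using insert.hyps by simp
          moreover have "(?w a)(i := e i k) = (\<lambda>j. if j \<in> insert i J then e j ((a(i := k)) j) else u j)"
            using insert.hyps by (auto simp: fun_eq_iff)
          ultimately show "sY (c i k * (\<Prod>j\<in>J. c j (a j))) (T ((?w a)(i := e i k)))
            = sY (\<Prod>j\<in>insert i J. c j ((a(i := k)) j))
          (T (\<lambda>j. if j \<in> insert i J then e j ((a(i := k)) j) else u j))"
            by simp
        qed
        finally show ?thesis .
      qed
      note step = this
      have "T u = (\<Sum>a\<in>Pi\<^sub>E J ?S. sY (\<Prod>j\<in>J. c j (a j)) (T (?w a)))"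
        using insert by blast
      also have "\<dots> = (\<Sum>a\<in>Pi\<^sub>E J ?S. \<Sum>k<m i. sY (\<Prod>j\<in>insert i J. c j ((a(i := k)) j))
          (T (\<lambda>j. if j \<in> insert i J then e j ((a(i := k)) j) else u j)))"
        by (intro sum.cong refl step)
      also have "\<dots> = (\<Sum>a\<in>Pi\<^sub>E (insert i J) ?S. sY (\<Prod>j\<in>insert i J. c j (a j))
          (T (\<lambda>j. if j \<in> insert i J then e j (a j) else u j)))"
        by (rule sum_PiE_insert[OF insert.hyps(2), symmetric])
      finally show ?case .
    qed
  qed
  from this[of "{1..n}"] have "T u = (\<Sum>a\<in>Pi\<^sub>E {1..n} ?S. sY (\<Prod>j\<in>{1..n}. c j (a j))
      (T (\<lambda>j. if j \<in> {1..n} then e j (a j) else u j)))" by blast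
  moreover have "(\<lambda>j. if j \<in> {1..n} then e j (a j) else u j) = (\<lambda>j\<in>{1..n}. e j (a j))" for a
    using u by (auto simp: fun_eq_iff PiE_iff extensional_def)
  ultimately show ?thesis by simp
qed

text \<open>
On a product of \<open>\<ell>\<^sub>1\<close>-spaces with bases \<open>e j\<close>, multilinear maps are determined by their values at the
tuples \<open>z a\<close> of basis vectors, and these values are arbitrary up to a bound, because the coefficients
\<open>\<mu> x a\<close> of \<open>x\<close> have absolute sum at most the product of the norms of its components.  In
particular every choice of scalars \<open>\<epsilon> a\<close> of modulus at most 1 is realised by a form of norm at most 1.
So the hypothesis on forms is the scalar hypothesis of Grothendieck's inequality for
\<open>w i a = \<mu> (u i) a - \<mu> (v i) a\<close>, and the inequality applies to the vectors \<open>T (z a)\<close> once a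
subspace \<open>G\<close> close to \<open>\<ell>\<^sub>2\<close> contains them.
\<close>

lemma multilinear_local_estimate:
  fixes sX :: "'k::real_or_complex \<Rightarrow> 'a::real_normed_vector \<Rightarrow> 'a"
    and sY :: "'k \<Rightarrow> 'b::real_normed_vector \<Rightarrow> 'b"
    and u v :: "nat \<Rightarrow> nat \<Rightarrow> 'a"
  assumes X: "normed_space_over sX" and Y: "normed_space_over sY"
    and sub: "\<And>j. j \<in> {1..n} \<Longrightarrow> module.subspace sX (F j)"
    and co: "\<And>j. j \<in> {1..n} \<Longrightarrow> normed_space_over.lp_coordinates sX 1 (l j) (F j) (m j) (e j) (c j)"
    and l: "\<And>j. j \<in> {1..n} \<Longrightarrow> l j \<ge> 1"
    and r: "r \<ge> 1"
    and coY: "\<And>S. finite S \<Longrightarrow>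
        \<exists>G d f g. S \<subseteq> G \<and> module.subspace sY G \<and> normed_space_over.lp_coordinates sY 2 r G d f g"
    and T: "multilinear_on sX sY n F T" and C: "C > 0"
    and TC: "\<And>x. x \<in> Pi\<^sub>E {1..n} F \<Longrightarrow> norm (T x) \<le> C * (\<Prod>j\<in>{1..n}. norm (x j))"
    and uv: "\<And>i. i \<in> {1..q} \<Longrightarrow> u i \<in> Pi\<^sub>E {1..n} F \<and> v i \<in> Pi\<^sub>E {1..n} F"
    and N: "\<And>\<phi>. multilinear_on sX (*) n F \<phi> \<Longrightarrow>
        (\<And>x. x \<in> Pi\<^sub>E {1..n} F \<Longrightarrow> norm (\<phi> x) \<le> (\<Prod>j\<in>{1..n}. norm (x j))) \<Longrightarrow>
        (\<Sum>i\<in>{1..q}. norm (\<phi> (u i) - \<phi> (v i))) \<le> N"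
  shows "(\<Sum>i\<in>{1..q}. norm (T (u i) - T (v i))) \<le> 1568 * r * (C * (\<Prod>j\<in>{1..n}. l j)) * N"
proof -
  interpret X: normed_space_over sX by fact
  interpret Y: normed_space_over sY by fact
  let ?J = "{1..n}"
  define A where "A = Pi\<^sub>E ?J (\<lambda>j. {..<m j})"
  have A: "finite A" unfolding A_def by (intro finite_PiE) auto
  define z where "z = (\<lambda>a. \<lambda>j\<in>?J. e j (a j))"
  define \<mu> where "\<mu> = (\<lambda>x a. \<Prod>j\<in>?J. c j (x j) (a j))"
  have eF: "e j k \<in> F j" "norm (e j k) \<le> l j" if "j \<in> ?J" "k < m j" for j k
    using co[OF that(1)] that(2) unfolding X.lp_coordinates_def by auto
  have cadd: "c j (x + y) k = c j x k + c j y k" if "j \<in> ?J" "x \<in> F j" "y \<in> F j" for j x y k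
    using co[OF that(1)] that unfolding X.lp_coordinates_def by blast
  have chom: "c j (sX s x) k = s * c j x k" if "j \<in> ?J" "x \<in> F j" for j x s k
    using co[OF that(1)] that unfolding X.lp_coordinates_def by blast
  have crep: "x = (\<Sum>k<m j. sX (c j x k) (e j k))" if "j \<in> ?J" "x \<in> F j" for j x
    using co[OF that(1)] that unfolding X.lp_coordinates_def by blast
  have cnorm: "(\<Sum>k<m j. norm (c j x k)) \<le> norm x" if "j \<in> ?J" "x \<in> F j" for j x
    using co[OF that(1)] that unfolding X.lp_coordinates_def lp_norm_1 by blast
  have zF: "z a \<in> Pi\<^sub>E ?J F" if "a \<in> A" for a
    using that eF by (fastforce simp: z_def A_def PiE_iff)
  have Tz: "norm (T (z a)) \<le> C * (\<Prod>j\<in>?J. l j)" if a: "a \<in> A" for a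
  proof -
    have "norm (T (z a)) \<le> C * (\<Prod>j\<in>?J. norm (z a j))" using TC[OF zF[OF a]] .
    also have "\<dots> \<le> C * (\<Prod>j\<in>?J. l j)"
      using C a eF by (intro mult_left_mono prod_mono) (auto simp: z_def A_def PiE_iff)
    finally show ?thesis .
  qed
  have Texp: "T x = (\<Sum>a\<in>A. sY (\<mu> x a) (T (z a)))" if x: "x \<in> Pi\<^sub>E ?J F" for x
    unfolding A_def \<mu>_def z_def
  proof (rule multilinear_on_expansion[OF X Y sub T x])
    show "x j = (\<Sum>k<m j. sX (c j (x j) k) (e j k))" if "j \<in> ?J" for j
      by (rule crep[OF that PiE_mem[OF x that]])
  qed (use eF in auto)
  have \<mu>_add: "\<mu> (x(i := y + y')) a = \<mu> (x(i := y)) a + \<mu> (x(i := y')) a"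
    if "i \<in> ?J" "y \<in> F i" "y' \<in> F i" for x i y y' a
  proof -
    have "(\<Prod>j\<in>?J. c j ((x(i := s)) j) (a j)) = c i s (a i) * (\<Prod>j\<in>?J - {i}. c j (x j) (a j))" for s
      using that by (subst prod.remove[of _ i]) (auto intro!: arg_cong2[of _ _ _ _ "(*)"] prod.cong)
    then show ?thesis
      using that by (simp add: \<mu>_def cadd algebra_simps)
  qed
  have \<mu>_hom: "\<mu> (x(i := sX s y)) a = s * \<mu> (x(i := y)) a"
    if "i \<in> ?J" "y \<in> F i" for x i y s a
  proof -
    have "(\<Prod>j\<in>?J. c j ((x(i := s)) j) (a j)) = c i s (a i) * (\<Prod>j\<in>?J - {i}. c j (x j) (a j))" for s
      using that by (subst prod.remove[of _ i]) (auto intro!: arg_cong2[of _ _ _ _ "(*)"] prod.cong)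
    then show ?thesis
      using that by (simp add: \<mu>_def chom algebra_simps)
  qed
  have \<mu>_norm: "(\<Sum>a\<in>A. norm (\<mu> x a)) \<le> (\<Prod>j\<in>?J. norm (x j))" if x: "x \<in> Pi\<^sub>E ?J F" for x
  proof -
    have "(\<Sum>a\<in>A. norm (\<mu> x a)) = (\<Prod>j\<in>?J. \<Sum>k<m j. norm (c j (x j) k))"
      unfolding A_def \<mu>_def prod_norm[symmetric]
      by (rule prod_sum_PiE) simp
    also have "\<dots> \<le> (\<Prod>j\<in>?J. norm (x j))"
      using x by (intro prod_mono) (auto intro!: cnorm sum_nonneg)
    finally show ?thesis .
  qed
  define w where "w = (\<lambda>i a. \<mu> (u i) a - \<mu> (v i) a)"
  have forms: "(\<Sum>i\<in>{1..q}. norm (\<Sum>a\<in>A. w i a * of_real (\<epsilon> a))) \<le> N"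
    if \<epsilon>: "\<And>a. a \<in> A \<Longrightarrow> \<bar>\<epsilon> a\<bar> \<le> 1" for \<epsilon> :: "(nat \<Rightarrow> nat) \<Rightarrow> real"
  proof -
    define \<phi> where "\<phi> = (\<lambda>x. \<Sum>a\<in>A. \<mu> x a * of_real (\<epsilon> a))"
    have "multilinear_on sX (*) n F \<phi>"
      by (simp add: multilinear_on_def \<phi>_def \<mu>_add \<mu>_hom algebra_simps sum.distrib sum_distrib_left)
    moreover have "norm (\<phi> x) \<le> (\<Prod>j\<in>?J. norm (x j))" if x: "x \<in> Pi\<^sub>E ?J F" for x
    proof -
      have "norm (\<phi> x) \<le> (\<Sum>a\<in>A. norm (\<mu> x a) * \<bar>\<epsilon> a\<bar>)"
        unfolding \<phi>_def using norm_sum[of "\<lambda>a. \<mu> x a * of_real (\<epsilon> a)" A] by (simp add: norm_mult)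
      also have "\<dots> \<le> (\<Sum>a\<in>A. norm (\<mu> x a))"
        using \<epsilon> by (intro sum_mono mult_left_le) auto
      finally show ?thesis using \<mu>_norm[OF x] by simp
    qed
    ultimately have "(\<Sum>i\<in>{1..q}. norm (\<phi> (u i) - \<phi> (v i))) \<le> N"
      by (rule N)
    then show ?thesis
      by (simp add: \<phi>_def w_def algebra_simps sum_subtractf)
  qed
  define S where "S = T ` z ` A"
  obtain G d f g where SG: "S \<subseteq> G" and G: "Y.subspace G" and coG: "Y.lp_coordinates 2 r G d f g"
    using coY[of S] A unfolding S_def by auto
  have gadd: "g (x + y) k = g x k + g y k" if "x \<in> G" "y \<in> G" for x y k
    using coG that unfolding Y.lp_coordinates_def by blast
  have ghom: "g (sY s x) k = s * g x k" if "x \<in> G" for x s k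
    using coG that unfolding Y.lp_coordinates_def by blast
  have gnorm: "lp_norm 2 d (g x) \<le> norm x" "norm x \<le> r * lp_norm 2 d (g x)" if "x \<in> G" for x
    using coG that unfolding Y.lp_coordinates_def by blast+
  define t where "t = (\<lambda>a. g (T (z a)))"
  have TzG: "T (z a) \<in> G" if "a \<in> A" for a
    using SG that by (auto simp: S_def)
  have gsum: "(\<Sum>a\<in>B. sY (s a) (T (z a))) \<in> G \<and>
      g (\<Sum>a\<in>B. sY (s a) (T (z a))) = (\<lambda>k. \<Sum>a\<in>B. s a * t a k)" if "B \<subseteq> A" for s B
  proof -
    have "finite B" using that A by (rule finite_subset)
    then show ?thesis using that
    proof (induction B rule: finite_induct)
      case empty
      have "g (sY 0 0) k = 0 * g 0 k" for k
        using Y.subspace_0[OF G] by (rule ghom)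
      then show ?case using Y.subspace_0[OF G] by (simp add: fun_eq_iff)
    next
      case (insert a B)
      then show ?case
        using TzG[of a] Y.subspace_scale[OF G] Y.subspace_add[OF G]
        by (simp add: gadd ghom t_def)
    qed
  qed
  have diff: "T (u i) - T (v i) = (\<Sum>a\<in>A. sY (w i a) (T (z a)))" if "i \<in> {1..q}" for i
    using Texp uv[OF that] by (simp add: w_def Y.scale_left_diff_distrib sum_subtractf)
  have "(\<Sum>i\<in>{1..q}. norm (T (u i) - T (v i)))
      \<le> (\<Sum>i\<in>{1..q}. r * lp_norm 2 d (\<lambda>k. \<Sum>a\<in>A. w i a * t a k))"
  proof (intro sum_mono)
    fix i assume "i \<in> {1..q}"
    then show "norm (T (u i) - T (v i)) \<le> r * lp_norm 2 d (\<lambda>k. \<Sum>a\<in>A. w i a * t a k)"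
      using gnorm(2)[OF conjunct1[OF gsum[OF order_refl, of "w i"]]] gsum[OF order_refl, of "w i"]
      by (simp add: diff)
  qed
  also have "\<dots> = r * (\<Sum>i\<in>{1..q}. lp_norm 2 d (\<lambda>k. \<Sum>a\<in>A. w i a * t a k))"
    by (simp add: sum_distrib_left)
  also have "\<dots> \<le> r * (1568 * N * (C * (\<Prod>j\<in>?J. l j)))"
  proof (intro mult_left_mono scalar_grothendieck_inequality forms)
    show "C * (\<Prod>j\<in>?J. l j) > 0"
      using C l by (intro mult_pos_pos prod_pos) (auto intro: less_le_trans[of 0 1])
    fix a assume "a \<in> A"
    then show "lp_norm 2 d (t a) \<le> C * (\<Prod>j\<in>?J. l j)"
      unfolding t_def using gnorm(1)[OF TzG] Tz by (meson order_trans)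
  qed (use r in auto)
  finally show ?thesis by (simp add: mult_ac)
qed

section \<open>Compactness of the ball of multilinear forms\<close>

lemma compact_cball_scalar: "compact (cball (0 :: 'k::real_or_complex) r)"
proof -
  obtain re im :: "'k \<Rightarrow> real" and j :: 'k where re: "real_part_map re" and im: "real_part_map im"
    and parts: "\<And>x. x = of_real (re x) + of_real (im x) * j"
    using real_or_complex_parts by blast
  let ?K = "(\<lambda>(a, b). of_real a + of_real b * j) ` ({- (2 * r)..2 * r} \<times> {- (2 * r)..2 * r})"
  have "compact ?K"
    unfolding case_prod_unfold
    by (intro compact_continuous_image compact_Times compact_Icc continuous_intros)
  moreover have "cball 0 r \<subseteq> ?K"
  proof
    fix x :: 'k assume "x \<in> cball 0 r"
    then have "norm x \<le> r" by simp
    moreover have "\<bar>re x\<bar> \<le> 2 * norm x" "\<bar>im x\<bar> \<le> 2 * norm x"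
      using re im unfolding real_part_map_def by blast+
    ultimately have "\<bar>re x\<bar> \<le> 2 * r" "\<bar>im x\<bar> \<le> 2 * r"
      by linarith+
    then show "x \<in> ?K"
      using parts[of x] by (intro image_eqI[of _ _ "(re x, im x)"]) auto
  qed
  ultimately have "compact (?K \<inter> cball 0 r)" "?K \<inter> cball 0 r = cball 0 r"
    by (auto intro: compact_Int_closed)
  then show ?thesis by simp
qed

text \<open>
Tychonoff's theorem, in the topology of pointwise convergence.
\<close>

lemma compact_pointwise_bounded:
  "compact {\<phi> :: 'u \<Rightarrow> 'k::real_or_complex. \<forall>x. norm (\<phi> x) \<le> R x}"
proof -
  have "compactin (product_topology (\<lambda>_. euclidean) UNIV) (Pi\<^sub>E UNIV (\<lambda>x. cball (0 :: 'k) (R x)))"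
    by (simp add: compactin_PiE compact_cball_scalar)
  moreover have "Pi\<^sub>E UNIV (\<lambda>x. cball (0 :: 'k) (R x)) = {\<phi> :: 'u \<Rightarrow> 'k. \<forall>x. norm (\<phi> x) \<le> R x}"
    by (auto simp: PiE_def Pi_def)
  ultimately show ?thesis
    by (simp add: euclidean_product_topology)
qed

text \<open>
By homogeneity, the bound on the product of the unit balls extends to all of the product.  It makes
the sums over differences of values uniformly bounded on the ball of forms, so that their supremum is
a genuine one.
\<close>

lemma form_ball_pointwise_bound:
  assumes X: "normed_space_over sX"
    and sub: "\<And>j. j \<in> {1..n} \<Longrightarrow> module.subspace sX (X j)"
    and \<phi>: "\<phi> \<in> form_ball sX n X" and x: "x \<in> Pi\<^sub>E {1..n} X"
  shows "norm (\<phi> x) \<le> (\<Prod>j\<in>{1..n}. norm (x j))"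
proof -
  interpret X: normed_space_over sX by fact
  have "\<phi> \<in> bounded_multilinear sX (*) n X" and le1: "multilinear_norm n X \<phi> \<le> 1"
    using \<phi> unfolding form_ball_def by blast+
  then obtain C where ml: "multilinear_on sX (*) n X \<phi>"
    and C: "\<forall>y\<in>Pi\<^sub>E {1..n} X. norm (\<phi> y) \<le> C * (\<Prod>j\<in>{1..n}. norm (y j))"
    unfolding bounded_multilinear_iff by blast
  define e where "e = (\<lambda>j. sX (of_real (1 / norm (x j))) (x j))"
  have eX: "e j \<in> X j" if "j \<in> {1..n}" for j
    unfolding e_def using that x by (intro X.subspace_scale sub) auto
  have e1: "norm (e j) \<le> 1" for j
    by (simp add: e_def X.norm_scale norm_divide)
  have xe: "x j = sX (of_real (norm (x j))) (e j)" for j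
    by (cases "x j = 0") (simp_all add: e_def)
  \<comment> \<open>scaling all arguments at once is the expansion over the one-term representations \<open>xe\<close>\<close>
  have "\<phi> x = (\<Sum>a\<in>Pi\<^sub>E {1..n} (\<lambda>_. {..<1::nat}).
      (\<Prod>j\<in>{1..n}. of_real (norm (x j))) * \<phi> (\<lambda>j\<in>{1..n}. e j))"
    by (rule multilinear_on_expansion[OF X normed_space_over_field sub ml x, where m = "\<lambda>_. 1"
          and e = "\<lambda>j _. e j" and c = "\<lambda>j _. of_real (norm (x j))"])
       (use eX xe[symmetric] in simp_all)
  also have "\<dots> = (\<Prod>j\<in>{1..n}. of_real (norm (x j))) * \<phi> (restrict e {1..n})"
    by (simp add: card_PiE)
  finally have eq: "norm (\<phi> x) = (\<Prod>j\<in>{1..n}. norm (x j)) * norm (\<phi> (restrict e {1..n}))"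
    by (simp only: norm_mult norm_of_real prod_norm[symmetric] abs_norm_cancel)
  have "norm (\<phi> y) \<le> \<bar>C\<bar>" if y: "y \<in> Pi\<^sub>E {1..n} (\<lambda>j. X j \<inter> cball 0 1)" for y
  proof -
    have "norm (\<phi> y) \<le> C * (\<Prod>j\<in>{1..n}. norm (y j))"
      using y by (intro bspec[OF C]) (auto simp: PiE_iff)
    also have "\<dots> \<le> \<bar>C\<bar> * (\<Prod>j\<in>{1..n}. norm (y j))"
      by (intro mult_right_mono prod_nonneg) auto
    also have "\<dots> \<le> \<bar>C\<bar> * 1"
      using y by (intro mult_left_mono prod_le_1) (auto simp: PiE_iff)
    finally show ?thesis by simp
  qed
  then have "bdd_above ((\<lambda>y. norm (\<phi> y)) ` Pi\<^sub>E {1..n} (\<lambda>j. X j \<inter> cball 0 1))"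
    by (intro bdd_aboveI2)
  moreover have "restrict e {1..n} \<in> Pi\<^sub>E {1..n} (\<lambda>j. X j \<inter> cball 0 1)"
    using eX e1 by auto
  ultimately have "norm (\<phi> (restrict e {1..n})) \<le> multilinear_norm n X \<phi>"
    unfolding multilinear_norm_def
    by (intro cSUP_upper[where f = "\<lambda>y. norm (\<phi> y)"])
  then have "norm (\<phi> (restrict e {1..n})) \<le> 1" using le1 by simp
  then show ?thesis
    unfolding eq by (intro mult_left_le prod_nonneg) auto
qed

text \<open>
Forms on products of subspaces \<open>F j\<close> need not extend to the whole product with control of the norm.
Instead, suppose that for every finite set \<open>W\<close> there is a good form on some product of subspaces
that contains \<open>W\<close>.  Extended by zero, it lies in the compact set of functions that satisfy the norm
bound pointwise, and it satisfies the equations of multilinearity for the vectors of \<open>W\<close>.  These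
conditions are closed, and finitely many sets \<open>W\<close> are contained in a single one, so some function
satisfies all of them.
\<close>

lemma form_ball_compactness:
  fixes sX :: "'k::real_or_complex \<Rightarrow> 'a::real_normed_vector \<Rightarrow> 'a"
  assumes X: "normed_space_over sX"
    and sub: "\<And>j. j \<in> {1..n} \<Longrightarrow> module.subspace sX (X j)"
    and loc: "\<And>W. finite W \<Longrightarrow> \<exists>F \<phi>.
      (\<forall>j\<in>{1..n}. module.subspace sX (F j) \<and> W \<inter> X j \<subseteq> F j \<and> F j \<subseteq> X j) \<and>
      (\<forall>i\<in>{1..q}. u i \<in> Pi\<^sub>E {1..n} F \<and> v i \<in> Pi\<^sub>E {1..n} F) \<and>
      multilinear_on sX (*) n F \<phi> \<and>
      (\<forall>x\<in>Pi\<^sub>E {1..n} F. norm (\<phi> x) \<le> (\<Prod>j\<in>{1..n}. norm (x j))) \<and>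
      N \<le> (\<Sum>i\<in>{1..q}. norm (\<phi> (u i) - \<phi> (v i)))"
  shows "\<exists>\<phi>\<in>form_ball sX n X. N \<le> (\<Sum>i\<in>{1..q}. norm (\<phi> (u i) - \<phi> (v i)))"
proof -
  interpret X: normed_space_over sX by fact
  let ?J = "{1..n}" and ?R = "\<lambda>x :: nat \<Rightarrow> 'a. \<Prod>j\<in>{1..n}. norm (x j)"
  define B where "B = {\<phi> :: (nat \<Rightarrow> 'a) \<Rightarrow> 'k. \<forall>x. norm (\<phi> x) \<le> ?R x}"
  define P where "P = (\<lambda>W. Pi\<^sub>E ?J (\<lambda>j. W \<inter> X j))"
  define A where "A = (\<lambda>W. (\<Inter>x\<in>P W. \<Inter>i\<in>?J. \<Inter>y\<in>W \<inter> X i. \<Inter>y'\<in>W \<inter> X i.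
        {\<phi> :: (nat \<Rightarrow> 'a) \<Rightarrow> 'k. \<phi> (x(i := y + y')) = \<phi> (x(i := y)) + \<phi> (x(i := y'))}) \<inter>
      (\<Inter>x\<in>P W. \<Inter>i\<in>?J. \<Inter>y\<in>W \<inter> X i. \<Inter>c. {\<phi>. \<phi> (x(i := sX c y)) = c * \<phi> (x(i := y))}) \<inter>
      {\<phi>. N \<le> (\<Sum>i\<in>{1..q}. norm (\<phi> (u i) - \<phi> (v i)))})"
  have A_iff: "\<phi> \<in> A W \<longleftrightarrow>
      (\<forall>x\<in>P W. \<forall>i\<in>?J. \<forall>y\<in>W \<inter> X i. \<forall>y'\<in>W \<inter> X i.
        \<phi> (x(i := y + y')) = \<phi> (x(i := y)) + \<phi> (x(i := y'))) \<and>
      (\<forall>x\<in>P W. \<forall>i\<in>?J. \<forall>y\<in>W \<inter> X i. \<forall>c. \<phi> (x(i := sX c y)) = c * \<phi> (x(i := y))) \<and>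
      N \<le> (\<Sum>i\<in>{1..q}. norm (\<phi> (u i) - \<phi> (v i)))" for \<phi> W
    by (simp only: A_def INT_iff Int_iff mem_Collect_eq conj_assoc UNIV_I simp_thms ball_UNIV)
  have evaluation: "continuous_on UNIV (\<lambda>\<phi> :: (nat \<Rightarrow> 'a) \<Rightarrow> 'k. \<phi> x)" for x
    by (rule continuous_on_product_coordinates)
  have closed_rules: "closed {\<phi> :: (nat \<Rightarrow> 'a) \<Rightarrow> 'k. \<phi> x = \<phi> y + \<phi> z}"
    "closed {\<phi> :: (nat \<Rightarrow> 'a) \<Rightarrow> 'k. \<phi> x = c * \<phi> y}"
    "closed {\<phi> :: (nat \<Rightarrow> 'a) \<Rightarrow> 'k. N \<le> (\<Sum>i\<in>{1..q}. norm (\<phi> (u i) - \<phi> (v i)))}" for x y z c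
    by (intro closed_Collect_eq closed_Collect_le evaluation continuous_on_add continuous_on_mult
        continuous_on_sum continuous_on_norm continuous_on_diff continuous_on_const)+
  have "B \<inter> (\<Inter>W\<in>{W. finite W}. A W) \<noteq> {}"
  proof (rule compact_imp_fip_image)
    show "compact B" unfolding B_def by (rule compact_pointwise_bounded)
    show "closed (A W)" for W
      unfolding A_def by (intro closed_Int closed_INT ballI closed_rules)
    fix \<W> :: "'a set set" assume \<W>: "finite \<W>" "\<W> \<subseteq> {W. finite W}"
    then have "finite (\<Union>\<W>)" by auto
    from loc[OF this] obtain F \<phi> where *:
      "(\<forall>j\<in>?J. X.subspace (F j) \<and> \<Union>\<W> \<inter> X j \<subseteq> F j \<and> F j \<subseteq> X j) \<and>
       (\<forall>i\<in>{1..q}. u i \<in> Pi\<^sub>E ?J F \<and> v i \<in> Pi\<^sub>E ?J F) \<and>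
       multilinear_on sX (*) n F \<phi> \<and>
       (\<forall>x\<in>Pi\<^sub>E ?J F. norm (\<phi> x) \<le> ?R x) \<and>
       N \<le> (\<Sum>i\<in>{1..q}. norm (\<phi> (u i) - \<phi> (v i)))"
      by (elim exE) (rule that)
    note F = *[THEN conjunct1] and uvF = *[THEN conjunct2, THEN conjunct1]
      and ml = *[THEN conjunct2, THEN conjunct2, THEN conjunct1]
      and bd = *[THEN conjunct2, THEN conjunct2, THEN conjunct2, THEN conjunct1]
      and N = *[THEN conjunct2, THEN conjunct2, THEN conjunct2, THEN conjunct2]
    define \<psi> where "\<psi> = (\<lambda>x. if x \<in> Pi\<^sub>E ?J F then \<phi> x else 0)"
    have "\<psi> \<in> B"
      using bd by (auto simp: B_def \<psi>_def prod_nonneg)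
    moreover have "\<psi> \<in> A W" if W: "W \<in> \<W>" for W
    proof -
      have WF: "y \<in> F j" if "j \<in> ?J" "y \<in> W" "y \<in> X j" for j y
        using F that W by blast
      have PF: "x \<in> Pi\<^sub>E ?J F" if "x \<in> P W" for x
        using that WF by (auto simp: P_def PiE_iff)
      have up: "x(i := y) \<in> Pi\<^sub>E ?J F" if "x \<in> Pi\<^sub>E ?J F" "i \<in> ?J" "y \<in> F i" for x i y
        using that by (auto simp: PiE_iff extensional_def)
      have Fadd: "y + y' \<in> F i" if "i \<in> ?J" "y \<in> F i" "y' \<in> F i" for i y y'
        using bspec[OF F that(1)] that X.subspace_add by blast
      have Fscale: "sX c y \<in> F i" if "i \<in> ?J" "y \<in> F i" for i y c
        using bspec[OF F that(1)] that X.subspace_scale by blast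
      have "\<psi> (x(i := y + y')) = \<psi> (x(i := y)) + \<psi> (x(i := y'))"
        if "x \<in> P W" "i \<in> ?J" "y \<in> W \<inter> X i" "y' \<in> W \<inter> X i" for x i y y'
      proof -
        have *: "x \<in> Pi\<^sub>E ?J F" "y \<in> F i" "y' \<in> F i" using that PF WF by auto
        then have "\<phi> (x(i := y + y')) = \<phi> (x(i := y)) + \<phi> (x(i := y'))"
          using ml that(2) unfolding multilinear_on_def by blast
        moreover have "x(i := y + y') \<in> Pi\<^sub>E ?J F" "x(i := y) \<in> Pi\<^sub>E ?J F" "x(i := y') \<in> Pi\<^sub>E ?J F"
          by (rule up[OF *(1) that(2)], rule *(2,3) Fadd[OF that(2) *(2,3)])+
        ultimately show ?thesis by (simp only: \<psi>_def if_True)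
      qed
      moreover have "\<psi> (x(i := sX c y)) = c * \<psi> (x(i := y))"
        if "x \<in> P W" "i \<in> ?J" "y \<in> W \<inter> X i" for x i y c
      proof -
        have *: "x \<in> Pi\<^sub>E ?J F" "y \<in> F i" using that PF WF by auto
        then have "\<phi> (x(i := sX c y)) = c * \<phi> (x(i := y))"
          using ml that(2) unfolding multilinear_on_def by blast
        moreover have "x(i := sX c y) \<in> Pi\<^sub>E ?J F" "x(i := y) \<in> Pi\<^sub>E ?J F"
          by (rule up[OF *(1) that(2)], rule *(2) Fscale[OF that(2) *(2)])+
        ultimately show ?thesis by (simp only: \<psi>_def if_True)
      qed
      moreover have "N \<le> (\<Sum>i\<in>{1..q}. norm (\<psi> (u i) - \<psi> (v i)))"
        using N uvF by (simp add: \<psi>_def)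
      ultimately show ?thesis unfolding A_iff by (intro conjI ballI allI)
    qed
    ultimately show "B \<inter> (\<Inter>W\<in>\<W>. A W) \<noteq> {}" by blast
  qed
  then obtain \<phi> where \<phi>B: "\<phi> \<in> B" and \<phi>A: "\<And>W. finite W \<Longrightarrow> \<phi> \<in> A W" by blast
  have "multilinear_on sX (*) n X \<phi>"
    unfolding multilinear_on_def
  proof (intro conjI ballI allI)
    fix x i y y' assume *: "x \<in> Pi\<^sub>E ?J X" "i \<in> ?J" "y \<in> X i" "y' \<in> X i"
    then have "x \<in> P (x ` ?J \<union> {y, y'})" by (auto simp: P_def PiE_iff)
    then show "\<phi> (x(i := y + y')) = \<phi> (x(i := y)) + \<phi> (x(i := y'))"
      using \<phi>A[of "x ` ?J \<union> {y, y'}"] * unfolding A_iff by (simp del: fun_upd_apply)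
  next
    fix x i y c assume *: "x \<in> Pi\<^sub>E ?J X" "i \<in> ?J" "y \<in> X i"
    then have "x \<in> P (x ` ?J \<union> {y})" by (auto simp: P_def PiE_iff)
    then show "\<phi> (x(i := sX c y)) = c * \<phi> (x(i := y))"
      using \<phi>A[of "x ` ?J \<union> {y}"] * unfolding A_iff by (simp del: fun_upd_apply)
  qed
  moreover have bd: "norm (\<phi> x) \<le> ?R x" for x
    using \<phi>B by (simp add: B_def)
  moreover have "multilinear_norm n X \<phi> \<le> 1"
    unfolding multilinear_norm_def
  proof (rule cSUP_least)
    have "(\<lambda>j\<in>?J. 0) \<in> Pi\<^sub>E ?J (\<lambda>j. X j \<inter> cball 0 1)"
      using X.subspace_0 sub by auto
    then show "Pi\<^sub>E ?J (\<lambda>j. X j \<inter> cball 0 1) \<noteq> {}" by blast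
    fix x assume "x \<in> Pi\<^sub>E ?J (\<lambda>j. X j \<inter> cball 0 1)"
    then have "?R x \<le> 1" by (intro prod_le_1) (auto simp: PiE_iff)
    then show "norm (\<phi> x) \<le> 1" using bd[of x] by simp
  qed
  ultimately have "\<phi> \<in> form_ball sX n X"
    unfolding form_ball_def bounded_multilinear_iff by (auto intro!: exI[of _ 1])
  moreover have "N \<le> (\<Sum>i\<in>{1..q}. norm (\<phi> (u i) - \<phi> (v i)))"
    using \<phi>A[of "{}"] unfolding A_iff by simp
  ultimately show ?thesis by blast
qed

section \<open>Multilinear operators from script-L-1 spaces to a script-L-2 space\<close>

lemma sum_norm_powr_1: "(\<Sum>i\<in>I. norm (f i) powr 1) powr (1 / 1) = (\<Sum>i\<in>I. norm (f i))"
  by (simp add: sum_nonneg)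

theorem corollary3p7:
  fixes scaleX :: "'k::real_or_complex \<Rightarrow> 'a::real_normed_vector \<Rightarrow> 'a"
    and scaleY :: "'k \<Rightarrow> 'b::banach \<Rightarrow> 'b"
    and n :: nat
    and X :: "nat \<Rightarrow> 'a set"
  assumes "normed_space_over scaleX"
    and "normed_space_over scaleY"
    and "\<And>i. i \<in> {1..n} \<Longrightarrow> module.subspace scaleX (X i)"
    and "\<And>i. i \<in> {1..n} \<Longrightarrow> complete (X i)"
    and "\<And>i. i \<in> {1..n} \<Longrightarrow> normed_space_over.script_L_space scaleX 1 (X i)"
    and "normed_space_over.script_L_space scaleY 2 UNIV"
  shows "lipschitz_summing 1 scaleX scaleY n X = bounded_multilinear scaleX scaleY n X"
proof
  show "lipschitz_summing 1 scaleX scaleY n X \<subseteq> bounded_multilinear scaleX scaleY n X"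
    unfolding lipschitz_summing_def by (rule Collect_restrict)
next
  interpret X: normed_space_over scaleX by fact
  interpret Y: normed_space_over scaleY by fact
  let ?J = "{1..n}"
  define Q where "Q = (\<lambda>j l. \<forall>S. finite S \<longrightarrow> X.span S \<subseteq> X j \<longrightarrow>
      (\<exists>F m e c. S \<subseteq> F \<and> F \<subseteq> X j \<and> X.subspace F \<and> X.lp_coordinates 1 l F m e c))"
  have "\<exists>l. l \<ge> 1 \<and> Q j l" if j: "j \<in> ?J" for j
  proof (rule X.script_L_space_coordinates[OF zero_less_one assms(5)[OF j]])
    fix l assume "l \<ge> 1" and "\<And>S. finite S \<Longrightarrow> X.span S \<subseteq> X j \<Longrightarrow>
      \<exists>F m e c. S \<subseteq> F \<and> F \<subseteq> X j \<and> X.subspace F \<and> X.lp_coordinates 1 l F m e c"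
    then show ?thesis unfolding Q_def by (intro exI[of _ l] conjI allI impI)
  qed
  then obtain l where l1: "\<And>j. j \<in> ?J \<Longrightarrow> l j \<ge> 1" and l: "\<And>j. j \<in> ?J \<Longrightarrow> Q j (l j)"
    by metis
  obtain r where r: "r \<ge> 1" and coY: "\<And>S. finite S \<Longrightarrow>
      \<exists>G d f g. S \<subseteq> G \<and> Y.subspace G \<and> Y.lp_coordinates 2 r G d f g"
  proof (rule Y.script_L_space_coordinates[OF zero_less_numeral assms(6)])
    fix l assume l: "l \<ge> 1" and ex: "\<And>S. finite S \<Longrightarrow> Y.span S \<subseteq> UNIV \<Longrightarrow>
      \<exists>F m e c. S \<subseteq> F \<and> F \<subseteq> UNIV \<and> Y.subspace F \<and> Y.lp_coordinates 2 l F m e c"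
    show thesis
    proof (rule that[OF l])
      fix S :: "'b set" assume "finite S"
      from ex[OF this subset_UNIV] obtain F m e c
        where "S \<subseteq> F \<and> F \<subseteq> UNIV \<and> Y.subspace F \<and> Y.lp_coordinates 2 l F m e c"
        by (elim exE) (rule that)
      then show "\<exists>G d f g. S \<subseteq> G \<and> Y.subspace G \<and> Y.lp_coordinates 2 l G d f g"
        by (intro exI[of _ F] exI[of _ m] exI[of _ e] exI[of _ c]) simp
    qed
  qed
  show "bounded_multilinear scaleX scaleY n X \<subseteq> lipschitz_summing 1 scaleX scaleY n X"
  proof
    fix T assume T: "T \<in> bounded_multilinear scaleX scaleY n X"
    then obtain C0 where ml: "multilinear_on scaleX scaleY n X T"
      and C0: "\<And>x. x \<in> Pi\<^sub>E ?J X \<Longrightarrow> norm (T x) \<le> C0 * (\<Prod>j\<in>?J. norm (x j))"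
      unfolding bounded_multilinear_iff by blast
    define C where "C = \<bar>C0\<bar> + 1"
    have C: "C > 0" by (simp add: C_def)
    have TC: "norm (T x) \<le> C * (\<Prod>j\<in>?J. norm (x j))" if "x \<in> Pi\<^sub>E ?J X" for x
    proof -
      have "C0 * (\<Prod>j\<in>?J. norm (x j)) \<le> C * (\<Prod>j\<in>?J. norm (x j))"
        by (intro mult_right_mono prod_nonneg) (auto simp: C_def)
      then show ?thesis using C0[OF that] by simp
    qed
    define K where "K = 1568 * r * (C * (\<Prod>j\<in>?J. l j))"
    have "(\<Prod>j\<in>?J. l j) > 0"
      using l1 by (intro prod_pos) (auto intro: less_le_trans[of 0 1])
    then have K: "K > 0" using r C by (simp add: K_def)
    have main: "(\<Sum>i\<in>{1..q}. norm (T (u i) - T (v i)))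
        \<le> K * (SUP \<phi>\<in>form_ball scaleX n X. \<Sum>i\<in>{1..q}. norm (\<phi> (u i) - \<phi> (v i)))"
      if uv: "\<And>i. i \<in> {1..q} \<Longrightarrow> u i \<in> Pi\<^sub>E ?J X \<and> v i \<in> Pi\<^sub>E ?J X" for q and u v :: "nat \<Rightarrow> nat \<Rightarrow> 'a"
    proof (rule ccontr)
      let ?S = "\<Sum>i\<in>{1..q}. norm (T (u i) - T (v i))"
      let ?\<Phi> = "\<lambda>\<phi>. \<Sum>i\<in>{1..q}. norm (\<phi> (u i) - \<phi> (v i))"
      let ?N0 = "SUP \<phi>\<in>form_ball scaleX n X. ?\<Phi> \<phi>"
      assume "\<not> ?S \<le> K * ?N0"
      then have "?N0 < ?S / K" using K by (simp add: field_simps)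
      \<comment> \<open>a form with value at least \<open>N\<close> would contradict the choice of \<open>N\<close> above the supremum\<close>
      then obtain N where N: "?N0 < N" "N < ?S / K" using dense by blast
      have "\<exists>\<phi>\<in>form_ball scaleX n X. N \<le> ?\<Phi> \<phi>"
      proof (rule form_ball_compactness[OF assms(1,3)])
        fix W :: "'a set" assume W: "finite W"
        \<comment> \<open>the subspaces have to contain the given points besides the vectors of \<open>W\<close>\<close>
        define S where "S = (\<lambda>j. (W \<inter> X j) \<union> (\<lambda>i. u i j) ` {1..q} \<union> (\<lambda>i. v i j) ` {1..q})"
        have "\<exists>F m e c. S j \<subseteq> F \<and> F \<subseteq> X j \<and> X.subspace F \<and> X.lp_coordinates 1 (l j) F m e c"
          if j: "j \<in> ?J" for j
        proof -
          have "finite (S j)" using W by (simp add: S_def)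
          moreover have "S j \<subseteq> X j" using uv j by (auto simp: S_def PiE_iff)
          then have "X.span (S j) \<subseteq> X j" using assms(3)[OF j] by (rule X.span_minimal)
          ultimately show ?thesis using l[OF j] unfolding Q_def by blast
        qed
        then obtain F m e c where F: "\<And>j. j \<in> ?J \<Longrightarrow> S j \<subseteq> F j \<and> F j \<subseteq> X j \<and> X.subspace (F j)"
          and co: "\<And>j. j \<in> ?J \<Longrightarrow> X.lp_coordinates 1 (l j) (F j) (m j) (e j) (c j)"
          by metis
        have FX: "x \<in> Pi\<^sub>E ?J X" if "x \<in> Pi\<^sub>E ?J F" for x
          using that F PiE_mono[of ?J F X] by blast
        have uvF: "u i \<in> Pi\<^sub>E ?J F \<and> v i \<in> Pi\<^sub>E ?J F" if "i \<in> {1..q}" for i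
        proof -
          have "u i j \<in> F j \<and> v i j \<in> F j" if "j \<in> ?J" for j
            using F[OF that] \<open>i \<in> {1..q}\<close> unfolding S_def by blast
          then show ?thesis using uv[OF \<open>i \<in> {1..q}\<close>] by (simp add: PiE_iff)
        qed
        have mlF: "multilinear_on scaleX scaleY n F T"
          using ml F by (intro multilinear_on_subset[where X = X and F = F]) blast+
        have "\<exists>\<phi>. multilinear_on scaleX (*) n F \<phi> \<and>
            (\<forall>x\<in>Pi\<^sub>E ?J F. norm (\<phi> x) \<le> (\<Prod>j\<in>?J. norm (x j))) \<and> N \<le> ?\<Phi> \<phi>"
        proof (rule ccontr)
          assume neg: "\<not> ?thesis"
          have "?S \<le> 1568 * r * (C * (\<Prod>j\<in>?J. l j)) * N"
          proof (rule multilinear_local_estimate[OF assms(1,2) _ co l1 r coY mlF C _ uvF])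
            show "?\<Phi> \<phi> \<le> N" if "multilinear_on scaleX (*) n F \<phi>"
              "\<And>x. x \<in> Pi\<^sub>E ?J F \<Longrightarrow> norm (\<phi> x) \<le> (\<Prod>j\<in>?J. norm (x j))" for \<phi>
            proof (rule ccontr)
              assume "\<not> ?\<Phi> \<phi> \<le> N"
              then have "N \<le> ?\<Phi> \<phi>" by linarith
              then show False using neg that by blast
            qed
          qed (use F FX TC in auto)
          then have "?S \<le> K * N" by (simp only: K_def)
          moreover have "K * N < ?S" using N(2) K by (simp add: field_simps)
          ultimately show False by linarith
        qed
        then obtain \<phi> where \<phi>: "multilinear_on scaleX (*) n F \<phi> \<and>
            (\<forall>x\<in>Pi\<^sub>E ?J F. norm (\<phi> x) \<le> (\<Prod>j\<in>?J. norm (x j))) \<and> N \<le> ?\<Phi> \<phi>"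
          by (elim exE) (rule that)
        have WF: "W \<inter> X j \<subseteq> F j" if "j \<in> ?J" for j
          using F[OF that] unfolding S_def by blast
        show "\<exists>F \<phi>. (\<forall>j\<in>?J. X.subspace (F j) \<and> W \<inter> X j \<subseteq> F j \<and> F j \<subseteq> X j) \<and>
          (\<forall>i\<in>{1..q}. u i \<in> Pi\<^sub>E ?J F \<and> v i \<in> Pi\<^sub>E ?J F) \<and> multilinear_on scaleX (*) n F \<phi> \<and>
          (\<forall>x\<in>Pi\<^sub>E ?J F. norm (\<phi> x) \<le> (\<Prod>j\<in>?J. norm (x j))) \<and> N \<le> ?\<Phi> \<phi>"
        proof (rule exI[of _ F], rule exI[of _ \<phi>], intro conjI ballI)
          fix j assume j: "j \<in> ?J"
          show "X.subspace (F j)" "F j \<subseteq> X j" using F[OF j] by blast+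
          show "W \<inter> X j \<subseteq> F j" using WF[OF j] .
        qed (use uvF \<phi> in blast)+
      qed
      then obtain \<phi> where \<phi>: "\<phi> \<in> form_ball scaleX n X" "N \<le> ?\<Phi> \<phi>" by (rule bexE)
      have "bdd_above (?\<Phi> ` form_ball scaleX n X)"
      proof (rule bdd_aboveI2)
        fix \<psi> assume "\<psi> \<in> form_ball scaleX n X"
        then have bound: "norm (\<psi> x) \<le> (\<Prod>j\<in>?J. norm (x j))" if "x \<in> Pi\<^sub>E ?J X" for x
          using that by (intro form_ball_pointwise_bound[OF assms(1,3)])
        show "?\<Phi> \<psi> \<le> (\<Sum>i\<in>{1..q}. (\<Prod>j\<in>?J. norm (u i j)) + (\<Prod>j\<in>?J. norm (v i j)))"
        proof (intro sum_mono)
          fix i assume "i \<in> {1..q}"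
          then have "norm (\<psi> (u i)) \<le> (\<Prod>j\<in>?J. norm (u i j))" "norm (\<psi> (v i)) \<le> (\<Prod>j\<in>?J. norm (v i j))"
            using bound uv by blast+
          then show "norm (\<psi> (u i) - \<psi> (v i)) \<le> (\<Prod>j\<in>?J. norm (u i j)) + (\<Prod>j\<in>?J. norm (v i j))"
            using norm_triangle_ineq4[of "\<psi> (u i)" "\<psi> (v i)"] by linarith
        qed
      qed
      then have "?\<Phi> \<phi> \<le> ?N0" using \<phi>(1) by (intro cSUP_upper)
      then show False using N(1) \<phi>(2) by simp
    qed
    show "T \<in> lipschitz_summing 1 scaleX scaleY n X"
      unfolding lipschitz_summing_def mem_Collect_eq sum_norm_powr_1
    proof (rule conjI[OF T], rule exI[of _ K], intro conjI K allI impI main)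
      fix q i and u v :: "nat \<Rightarrow> nat \<Rightarrow> 'a"
      assume "\<forall>i\<in>{1..q}. u i \<in> Pi\<^sub>E ?J X \<and> v i \<in> Pi\<^sub>E ?J X" and "i \<in> {1..q}"
      then show "u i \<in> Pi\<^sub>E ?J X" "v i \<in> Pi\<^sub>E ?J X" by blast+
    qed
  qed
qed

end
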